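(* Every well-shaped mesh $G=(V,E)$ in $d$ dimensions ($d>1$ a constant) has a layout (an ordering of its vertices) such that, for every block size $B$ and cache size $M$ with $M=\Omega(B^d)$, a mesh update of $G$ performed in the order of this layout uses $O(1+|G|/B)$ memory transfers; the same layout works for all such $B$ and $M$ (i.e. cache-obliviously).
   Context: A well-shaped mesh in $d$ dimensions is the graph $G=(V,E)$ (vertices and edges) of a decomposition of a geometric domain in $\mathbb{R}^d$ into interior-disjoint simplices, any two of which intersect only in a lower-dimensional simplex, where every simplex has aspect ratio (radius of the smallest ball containing it divided by radius of the largest ball contained in it) bounded by a fixed constant; such a mesh has maximum degree bounded by a constant. Write $|G|=|V|+|E|$. Asymptotic constants may depend on $d$ and on the aspect-ratio bound. Memory transfers are counted in the disk-access machine (DAM) model: a cache of size $M$, an unbounded disk, data moved in blocks of $B$ words, each block transfer costing one unit. A layout stores the vertex records (each record containing the vertex's weight and its incident edges with edge weights and neighbor indices) contiguously in memory in the chosen vertex order. A mesh update, given vertex weights $w$ and edge weights $e$, recomputes for each vertex $i$, in layout order, the value $w_i=\sum_{(i,j)\in E} w_j e_{ij}$. *)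

theory Defs
  imports "HOL-Analysis.Analysis"
begin

definition is_d_simplex :: "(real^'n) set \<Rightarrow> bool" where
  "is_d_simplex S \<longleftrightarrow> finite S \<and> card S = CARD('n) + 1 \<and> \<not> affine_dependent S"

definition enclosing_radius :: "(real^'n) set \<Rightarrow> real" where
  "enclosing_radius K = Inf {r. \<exists>x. K \<subseteq> cball x r}"

definition inscribed_radius :: "(real^'n) set \<Rightarrow> real" where
  "inscribed_radius K = Sup {r. \<exists>x. cball x r \<subseteq> K}"

definition aspect_ratio :: "(real^'n) set \<Rightarrow> real" where
  "aspect_ratio K = enclosing_radius K / inscribed_radius K"

definition well_shaped_mesh :: "real \<Rightarrow> (real^'n) set set \<Rightarrow> bool" where
  "well_shaped_mesh \<alpha> T \<longleftrightarrow>
     finite T \<and>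
     (\<forall>S\<in>T. is_d_simplex S \<and> aspect_ratio (convex hull S) \<le> \<alpha>) \<and>
     (\<forall>S\<in>T. \<forall>S'\<in>T. S \<noteq> S' \<longrightarrow>
        interior (convex hull S) \<inter> interior (convex hull S') = {} \<and>
        convex hull S \<inter> convex hull S' = convex hull (S \<inter> S'))"

definition mesh_vertices :: "(real^'n) set set \<Rightarrow> (real^'n) set" where
  "mesh_vertices T = \<Union>T"

definition mesh_adj :: "(real^'n) set set \<Rightarrow> real^'n \<Rightarrow> real^'n \<Rightarrow> bool" where
  "mesh_adj T p q \<longleftrightarrow> p \<noteq> q \<and> (\<exists>S\<in>T. p \<in> S \<and> q \<in> S)"

definition mesh_edges :: "(real^'n) set set \<Rightarrow> (real^'n) set set" where
  "mesh_edges T = {{p, q} | p q. mesh_adj T p q}"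

definition mesh_size :: "(real^'n) set set \<Rightarrow> nat" where
  "mesh_size T = card (mesh_vertices T) + card (mesh_edges T)"

definition is_layout :: "(real^'n) set set \<Rightarrow> (real^'n) list \<Rightarrow> bool" where
  "is_layout T vs \<longleftrightarrow> distinct vs \<and> set vs = mesh_vertices T"

definition nbr_idx :: "(real^'n) set set \<Rightarrow> (real^'n) list \<Rightarrow> nat \<Rightarrow> nat list" where
  "nbr_idx T vs i = filter (\<lambda>j. mesh_adj T (vs ! i) (vs ! j)) [0..<length vs]"

text \<open>Record of a vertex: its weight word, then for each incident edge the edge weight
  and the neighbour index (one word each).\<close>
definition rec_size :: "(real^'n) set set \<Rightarrow> (real^'n) list \<Rightarrow> nat \<Rightarrow> nat" where
  "rec_size T vs i = 1 + 2 * length (nbr_idx T vs i)"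

definition rec_start :: "(real^'n) set set \<Rightarrow> (real^'n) list \<Rightarrow> nat \<Rightarrow> nat" where
  "rec_start T vs i = (\<Sum>j<i. rec_size T vs j)"

text \<open>Word accesses for updating the i-th vertex: read own weight word, for each incident
  edge read the edge weight, the neighbour index and the neighbour's weight word,
  finally write the own weight word.\<close>
definition vertex_trace :: "(real^'n) set set \<Rightarrow> (real^'n) list \<Rightarrow> nat \<Rightarrow> nat list" where
  "vertex_trace T vs i =
     (let s = rec_start T vs i; ns = nbr_idx T vs i in
      [s] @ concat (map (\<lambda>k. [s + 1 + 2 * k, s + 2 + 2 * k, rec_start T vs (ns ! k)])
                        [0..<length ns]) @ [s])"

definition mesh_update_trace :: "(real^'n) set set \<Rightarrow> (real^'n) list \<Rightarrow> nat list" where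
  "mesh_update_trace T vs = concat (map (vertex_trace T vs) [0..<length vs])"

text \<open>A run of the cache on an address trace: Cs ! k is the set of blocks in cache before
  the k-th access; the cache starts empty, holds at most M div B blocks, and the block of
  each accessed word is in cache when it is accessed.\<close>
definition cache_run :: "nat \<Rightarrow> nat \<Rightarrow> nat list \<Rightarrow> nat set list \<Rightarrow> bool" where
  "cache_run M B tr Cs \<longleftrightarrow>
     length Cs = Suc (length tr) \<and> Cs ! 0 = {} \<and>
     (\<forall>k\<le>length tr. finite (Cs ! k) \<and> card (Cs ! k) \<le> M div B) \<and>
     (\<forall>k<length tr. tr ! k div B \<in> Cs ! Suc k)"

definition transfers :: "nat set list \<Rightarrow> nat" where
  "transfers Cs = (\<Sum>k<length Cs - 1. card (Cs ! Suc k - Cs ! k))"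

end

theory Submission
  imports Defs
begin

text \<open>If a set \<open>W\<close> of \<open>m\<close> mesh vertices is given, take a smallest ball centred in \<open>W\<close> that contains a
  fixed fraction \<open>\<delta>\<close> of \<open>W\<close>, and let \<open>\<rho>\<close> be its radius. A concentric ball of radius
  \<open>r \<in> [\<rho>, 2\<rho>]\<close> is covered by boundedly many smaller ones, so it contains at least \<open>\<delta>m\<close> and at
  most \<open>m/2\<close> vertices, and on average over \<open>r\<close> its sphere cuts an edge of length \<open>\<ell>\<close> with probability
  at most \<open>min 1 (\<ell>/\<rho>)\<close>. Every edge occupies, inside one of its simplices, a ball of radius
  proportional to \<open>min \<rho> \<ell>\<close>, and these balls are essentially disjoint; comparing volumes bounds the
  average cut by \<open>O(m powr (1 - 1/d))\<close> (separator argument in the style of Har-Peled).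

  Separating recursively and concatenating the layouts of the two sides gives one vertex order. For
  every \<open>k\<close>, stopping the recursion at sets of size at most \<open>k\<close> cuts this order into \<open>O(1 + n/k)\<close>
  segments with \<open>O(n / k powr (1/d))\<close> edges between different segments. For \<open>k = B^d\<close> a segment fits
  into the cache; loading the segments one after the other costs \<open>O(1 + n/B)\<close> transfers, and each
  access that leaves the current segment costs one more, again \<open>O(n/B)\<close> in total.\<close>

subsection \<open>Caching a trace phase by phase\<close>

lemma transfers_Nil: "transfers [C] = 0"
  by (simp add: transfers_def)

lemma transfers_Cons: "transfers (C # D # Cs) = card (D - C) + transfers (D # Cs)"
  unfolding transfers_def by (simp del: sum.lessThan_Suc add: sum.lessThan_Suc_shift)

text \<open>An access annotated with the working set \<open>W\<close> of its phase leaves exactly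
  \<open>W\<close> and the accessed block in the cache. A block outside \<open>W\<close> is thus
  evicted by the next access to any other block, and one spare slot beyond \<open>W\<close>
  suffices.\<close>

abbreviation load :: "nat \<Rightarrow> nat set \<times> nat \<Rightarrow> nat set" where
  "load B \<equiv> \<lambda>(W, a). insert (a div B) W"

text \<open>Once \<open>W\<close> is resident, an access to one of its blocks moves nothing and any
  other access brings in a single block. The bound \<open>X\<close> is assumed for every starting
  cache, since the spare slot may hold any block when the phase ends.\<close>

lemma transfers_phase_resident:
  assumes "\<And>C. transfers (C # map (load B) rest) \<le> X" and "W \<subseteq> C" and "finite W"
  shows "transfers (C # map (load B) (map (Pair W) as @ rest))
           \<le> length (filter (\<lambda>a. a div B \<notin> W) as) + X"
  using assms(2)
proof (induction as arbitrary: C)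
  case Nil
  then show ?case using assms(1) by simp
next
  case (Cons a as)
  let ?D = "insert (a div B) W"
  have "?D - C \<subseteq> (if a div B \<notin> W then {a div B} else {})"
    using Cons.prems by auto
  then have "card (?D - C) \<le> card (if a div B \<notin> W then {a div B} else {})"
    by (intro card_mono) auto
  moreover have "transfers (?D # map (load B) (map (Pair W) as @ rest))
      \<le> length (filter (\<lambda>a. a div B \<notin> W) as) + X"
    by (rule Cons.IH) auto
  ultimately show ?case
    by (auto simp: transfers_Cons split: if_splits)
qed

text \<open>The first access of a phase also brings in the whole of \<open>W\<close>, at a cost of
  at most \<open>card W\<close>, whatever the previous phase left behind; afterwards
  \<open>W\<close> stays resident.\<close>

lemma transfers_phases:
  assumes "\<And>W as. (W, as) \<in> set phs \<Longrightarrow> finite W"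
  shows "transfers (C # map (load B) (concat (map (\<lambda>(W, as). map (Pair W) as) phs)))
     \<le> (\<Sum>(W, as)\<leftarrow>phs. card W + length (filter (\<lambda>a. a div B \<notin> W) as))"
  using assms
proof (induction phs arbitrary: C)
  case Nil
  then show ?case by (simp add: transfers_Nil)
next
  case (Cons ph phs)
  obtain W as where ph: "ph = (W, as)" by (cases ph)
  have finW: "finite W" using Cons.prems ph by auto
  let ?rest = "concat (map (\<lambda>(W, as). map (Pair W) as) phs)"
  let ?X = "\<Sum>(W, as)\<leftarrow>phs. card W + length (filter (\<lambda>a. a div B \<notin> W) as)"
  have IH: "transfers (C # map (load B) ?rest) \<le> ?X" for C
    using Cons.IH Cons.prems by auto
  show ?case
  proof (cases as)
    case Nil
    then show ?thesis using IH[of C] ph by (simp add: trans_le_add2)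
  next
    case (Cons a as')
    let ?D = "insert (a div B) W"
    have "card (?D - C) \<le> card ?D"
      using finW by (intro card_mono) auto
    then have "card (?D - C) \<le> card W + (if a div B \<notin> W then 1 else 0)"
      using finW by (auto simp: card_insert_if split: if_splits)
    moreover have "transfers (?D # map (load B) (map (Pair W) as' @ ?rest))
        \<le> length (filter (\<lambda>a. a div B \<notin> W) as') + ?X"
      using IH finW by (intro transfers_phase_resident) auto
    ultimately show ?thesis
      using Cons ph by (auto simp: transfers_Cons split: if_splits)
  qed
qed

lemma phased_cache_run:
  assumes "\<And>W as. (W, as) \<in> set phs \<Longrightarrow> finite W \<and> card W + 1 \<le> M div B"
  shows "\<exists>Cs. cache_run M B (concat (map snd phs)) Cs \<and>
     transfers Cs \<le> (\<Sum>(W, as)\<leftarrow>phs. card W + length (filter (\<lambda>a. a div B \<notin> W) as))"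
proof -
  define ann where "ann = concat (map (\<lambda>(W, as). map (Pair W) as) phs)"
  have tr: "map snd ann = concat (map snd phs)"
    unfolding ann_def by (induction phs) (auto simp: o_def)
  have len: "length (concat (map snd phs)) = length ann"
    by (metis tr length_map)
  have fits: "finite (load B x) \<and> card (load B x) \<le> M div B" if "x \<in> set ann" for x
  proof -
    obtain W a where x: "x = (W, a)" by (cases x)
    then have "finite W \<and> card W + 1 \<le> M div B"
      using that assms unfolding ann_def by auto
    then show ?thesis using x by (auto simp: card_insert_if)
  qed
  have "cache_run M B (concat (map snd phs)) ({} # map (load B) ann)"
    unfolding cache_run_def len
  proof (intro conjI allI impI)
    fix k assume "k \<le> length ann"
    then show "finite (({} # map (load B) ann) ! k)" "card (({} # map (load B) ann) ! k) \<le> M div B"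
      using fits by (cases k; simp)+
  next
    fix k assume k: "k < length ann"
    have "concat (map snd phs) ! k = snd (ann ! k)"
      using k tr by (metis nth_map)
    then show "concat (map snd phs) ! k div B \<in> ({} # map (load B) ann) ! Suc k"
      using k by (simp add: case_prod_unfold)
  qed auto
  moreover have "transfers ({} # map (load B) ann)
      \<le> (\<Sum>(W, as)\<leftarrow>phs. card W + length (filter (\<lambda>a. a div B \<notin> W) as))"
    unfolding ann_def by (rule transfers_phases) (use assms in auto)
  ultimately show ?thesis by blast
qed

subsection \<open>Layouts from balanced separators\<close>

text \<open>The pairs are ordered: an edge between two segments counts once from each end, just as
  each end reads the weight of the other during an update.\<close>

definition crossing :: "('a \<Rightarrow> 'a \<Rightarrow> bool) \<Rightarrow> 'a list list \<Rightarrow> ('a \<times> 'a) set" where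
  "crossing E ss = {(p, q). p \<in> set (concat ss) \<and> q \<in> set (concat ss) \<and> E p q \<and>
     \<not> (\<exists>s\<in>set ss. p \<in> set s \<and> q \<in> set s)}"

lemma finite_crossing: "finite (crossing E ss)"
  by (rule finite_subset[of _ "set (concat ss) \<times> set (concat ss)"]) (auto simp: crossing_def)

definition cut :: "('a \<Rightarrow> 'a \<Rightarrow> bool) \<Rightarrow> 'a set \<Rightarrow> 'a set \<Rightarrow> ('a \<times> 'a) set" where
  "cut E A D = {(p, q). p \<in> A \<and> q \<in> D \<and> E p q}"

text \<open>A new crossing pair joins the two sides, in either orientation, whereas
  \<open>cut\<close> records only one orientation; hence the factor 2.\<close>

lemma card_crossing_append:
  assumes "symp E"
  shows "card (crossing E (ss @ ts)) \<le> card (crossing E ss) + card (crossing E ts)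
           + 2 * card (cut E (set (concat ss)) (set (concat ts)))"
proof -
  let ?K = "cut E (set (concat ss)) (set (concat ts))"
  have K: "finite ?K"
    by (rule finite_subset[of _ "set (concat ss) \<times> set (concat ts)"]) (auto simp: cut_def)
  have "crossing E (ss @ ts) \<subseteq> (crossing E ss \<union> crossing E ts) \<union> (?K \<union> prod.swap ` ?K)"
    using assms unfolding crossing_def cut_def
    by (auto dest: sympD simp: image_iff)
  then have "card (crossing E (ss @ ts))
      \<le> card ((crossing E ss \<union> crossing E ts) \<union> (?K \<union> prod.swap ` ?K))"
    using K finite_crossing by (intro card_mono) auto
  also have "\<dots> \<le> card (crossing E ss) + card (crossing E ts) + (card ?K + card (prod.swap ` ?K))"
    by (meson add_mono card_Un_le le_trans)
  also have "card (prod.swap ` ?K) \<le> card ?K"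
    by (rule card_image_le[OF K])
  finally show ?thesis by simp
qed

text \<open>Write \<open>x powr (1 - \<beta>)\<close> as \<open>x * x powr - \<beta>\<close>. The
  smaller part is at most half of the whole, so its factor \<open>x powr - \<beta>\<close> grows by
  at least \<open>2 powr \<beta>\<close>, and this part carries at least a fraction
  \<open>\<delta>\<close> of the total.\<close>

lemma balanced_split_powr:
  fixes a b \<delta> \<beta> :: real
  assumes "0 < \<beta>" "0 < a" "0 < b" "\<delta> * (a + b) \<le> a" "\<delta> * (a + b) \<le> b" 
  shows "(1 + \<delta> * (2 powr \<beta> - 1)) * (a + b) powr (1 - \<beta>) \<le> a powr (1 - \<beta>) + b powr (1 - \<beta>)"
  using assms
proof (induction a b rule: linorder_wlog)
  case (sym a b)
  then show ?case by (simp add: add.commute)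
next
  case (le a b)
  let ?m = "a + b"
  have pow: "x powr (1 - \<beta>) = x * x powr - \<beta>" if "0 < x" for x :: real
    using that by (simp add: powr_diff powr_minus divide_inverse)
  have "a \<le> ?m / 2" using le by simp
  then have "(?m / 2) powr - \<beta> \<le> a powr - \<beta>"
    using le by (intro powr_mono2') auto
  then have "2 powr \<beta> * ?m powr - \<beta> \<le> a powr - \<beta>"
    using le by (simp add: powr_divide powr_minus divide_simps mult.commute)
  then have 1: "a * (2 powr \<beta> * ?m powr - \<beta>) \<le> a powr (1 - \<beta>)"
    using le by (simp add: pow)
  have "?m powr - \<beta> \<le> b powr - \<beta>"
    using le by (intro powr_mono2') auto
  then have 2: "b * ?m powr - \<beta> \<le> b powr (1 - \<beta>)"
    using le by (simp add: pow)
  have g: "1 \<le> 2 powr \<beta>" using le by (simp add: ge_one_powr_ge_zero)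
  have "(1 + \<delta> * (2 powr \<beta> - 1)) * ?m powr (1 - \<beta>)
      = (?m + (\<delta> * ?m) * (2 powr \<beta> - 1)) * ?m powr - \<beta>"
    using le by (simp add: pow algebra_simps)
  also have "\<dots> \<le> (?m + a * (2 powr \<beta> - 1)) * ?m powr - \<beta>"
    using le g by (intro mult_right_mono add_left_mono) auto
  also have "\<dots> = a * (2 powr \<beta> * ?m powr - \<beta>) + b * ?m powr - \<beta>"
    by (simp add: algebra_simps)
  finally show ?case using 1 2 by linarith
qed

text \<open>The recursive bisection never refers to \<open>k\<close>; only the level at which a part
  is declared a segment does. So one order serves all \<open>k\<close>, and the cuts are accounted
  for by a potential instead of level by level.\<close>

lemma separator_layout:
  fixes E :: "'a \<Rightarrow> 'a \<Rightarrow> bool" and \<delta> \<beta> C L K :: real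
  assumes "symp E" "finite V" and \<delta>: "0 < \<delta>" and \<beta>: "0 < \<beta>" and C: "0 \<le> C"
    and sep: "\<And>W. W \<subseteq> V \<Longrightarrow> 2 \<le> card W \<Longrightarrow> \<exists>A\<subseteq>W. \<delta> * card W \<le> card A \<and>
      \<delta> * card W \<le> card (W - A) \<and> card (cut E A (W - A)) \<le> C * card W powr (1 - \<beta>)"
  defines "L \<equiv> 2 * C / (\<delta> * (2 powr \<beta> - 1))"
  defines "K \<equiv> L * \<delta> powr - \<beta>"
  shows "\<exists>vs. distinct vs \<and> set vs = V \<and> (\<forall>k::nat. k \<ge> 1 \<longrightarrow>
    (\<exists>ss. concat ss = vs \<and> (\<forall>s\<in>set ss. length s \<le> k) \<and>
       length ss \<le> 1 + card V / (\<delta> * k) \<and> card (crossing E ss) \<le> K * card V / k powr \<beta>))"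
proof -
  have g: "0 < \<delta> * (2 powr \<beta> - 1)" using \<delta> \<beta> by simp
  have L: "0 \<le> L" unfolding L_def using g C by simp
  have K: "0 \<le> K" unfolding K_def using L by simp
  \<comment> \<open>The term \<open>L * m powr (1 - \<beta>)\<close> is slack: splitting \<open>m\<close> in a balanced way increases its sum over
    the parts by enough to pay for the cut.\<close>
  let ?good = "\<lambda>m k ss. m \<le> k \<and> length ss = 1 \<and> card (crossing E ss) = 0 \<or>
       real k < m \<and> length ss \<le> m / (\<delta> * k) \<and>
       card (crossing E ss) + L * m powr (1 - \<beta>) \<le> K * m / k powr \<beta>"
  \<comment> \<open>A part that fits into one segment but was split off from a set larger than
    \<open>k\<close> has at least \<open>\<delta> * k\<close> elements. It then satisfies the second
    form of the invariant as well, and the factor \<open>\<delta> powr - \<beta>\<close> in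
    \<open>K\<close> is what this takes.\<close>
  have weaken: "length ss \<le> m / (\<delta> * k) \<and>
      card (crossing E ss) + L * m powr (1 - \<beta>) \<le> K * m / k powr \<beta>"
    if "?good m k ss" "\<delta> * k \<le> m" "0 < m" "1 \<le> k" for m :: real and k :: nat and ss
    using that(1)
  proof
    assume *: "m \<le> k \<and> length ss = 1 \<and> card (crossing E ss) = 0"
    have "m powr - \<beta> \<le> (\<delta> * k) powr - \<beta>"
      using that \<delta> \<beta> by (intro powr_mono2') auto
    then have "m * m powr - \<beta> \<le> m * (\<delta> powr - \<beta> * k powr - \<beta>)"
      using that \<delta> by (simp add: powr_mult)
    moreover have "m powr (1 - \<beta>) = m * m powr - \<beta>"
      using that by (simp add: powr_diff powr_minus divide_inverse)
    ultimately have "L * m powr (1 - \<beta>) \<le> L * (m * (\<delta> powr - \<beta> * k powr - \<beta>))"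
      using L by (intro mult_left_mono) auto
    also have "\<dots> = K * m / k powr \<beta>"
      by (simp add: K_def powr_minus divide_inverse)
    finally show ?thesis using * that \<delta> by simp
  qed auto
  have "\<exists>vs. distinct vs \<and> set vs = W \<and> (\<forall>k::nat. k \<ge> 1 \<longrightarrow>
      (\<exists>ss. concat ss = vs \<and> (\<forall>s\<in>set ss. length s \<le> k) \<and> ?good (real (card W)) k ss))"
    if "W \<subseteq> V" for W
    using that
  proof (induction "card W" arbitrary: W rule: less_induct)
    case less
    have finW: "finite W" using less.prems \<open>finite V\<close> finite_subset by blast
    have single: "crossing E [vs] = {}" for vs by (auto simp: crossing_def)
    show ?case
    proof (cases "card W < 2")
      case True
      obtain vs where vs: "distinct vs" "set vs = W" using finite_distinct_list[OF finW] by blast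
      \<comment> \<open>Sets too small to be separated form one segment, possibly the empty list,
        which is short enough because \<open>k \<ge> 1\<close>.\<close>
      have "length vs \<le> 1" using True vs distinct_card by fastforce
      then show ?thesis
        using vs True by (intro exI[of _ vs]) (auto intro!: exI[of _ "[vs]"] simp: single)
    next
      case False
      then obtain A where A: "A \<subseteq> W" "\<delta> * card W \<le> card A" "\<delta> * card W \<le> card (W - A)"
        "card (cut E A (W - A)) \<le> C * card W powr (1 - \<beta>)"
        using sep[of W] less.prems by force
      let ?D = "W - A"
      have cW: "card A + card ?D = card W"
        using A finW by (metis card_Diff_subset card_mono finite_subset le_add_diff_inverse)
      have "0 < \<delta> * card W" using False \<delta> by simp
      then have pos: "0 < card A" "0 < card ?D" using A by linarith+
      have lt: "card A < card W" "card ?D < card W" using pos cW by linarith+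
      have sub: "A \<subseteq> V" "?D \<subseteq> V" using A less.prems by auto
      obtain as where as: "distinct as" "set as = A"
        and as': "\<And>k. k \<ge> 1 \<Longrightarrow> \<exists>ss. concat ss = as \<and> (\<forall>s\<in>set ss. length s \<le> k) \<and>
            ?good (real (card A)) k ss"
        using less.hyps[OF lt(1) sub(1)] by blast
      obtain ds where ds: "distinct ds" "set ds = ?D"
        and ds': "\<And>k. k \<ge> 1 \<Longrightarrow> \<exists>ss. concat ss = ds \<and> (\<forall>s\<in>set ss. length s \<le> k) \<and>
            ?good (real (card ?D)) k ss"
        using less.hyps[OF lt(2) sub(2)] by blast
      have "\<exists>ss. concat ss = as @ ds \<and> (\<forall>s\<in>set ss. length s \<le> k) \<and> ?good (real (card W)) k ss"
        if k: "k \<ge> 1" for k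
      proof (cases "card W \<le> k")
        case True
        have "length (as @ ds) = card W"
          using as ds cW by (simp add: distinct_card[symmetric])
        then show ?thesis
          using True by (intro exI[of _ "[as @ ds]"]) (auto simp: single)
      next
        case False
        obtain sa where sa: "concat sa = as" "\<forall>s\<in>set sa. length s \<le> k" "?good (real (card A)) k sa"
          using as'[OF k] by blast
        obtain sd where sd: "concat sd = ds" "\<forall>s\<in>set sd. length s \<le> k" "?good (real (card ?D)) k sd"
          using ds'[OF k] by blast
        have "\<delta> * k \<le> \<delta> * card W" using False \<delta> by simp
        then have ak: "\<delta> * k \<le> card A" and dk: "\<delta> * k \<le> card ?D" using A by linarith+
        note wa = weaken[OF sa(3) ak _ k] and wd = weaken[OF sd(3) dk _ k]
        have len: "length (sa @ sd) \<le> card W / (\<delta> * k)"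
          using wa wd pos by (simp add: cW[symmetric] add_divide_distrib)
        have "(1 + \<delta> * (2 powr \<beta> - 1)) * real (card W) powr (1 - \<beta>)
            \<le> real (card A) powr (1 - \<beta>) + real (card ?D) powr (1 - \<beta>)"
          using balanced_split_powr[of \<beta> "card A" "card ?D" \<delta>] A pos \<beta> cW
          by (metis of_nat_0_less_iff of_nat_add)
        then have "L * ((1 + \<delta> * (2 powr \<beta> - 1)) * real (card W) powr (1 - \<beta>))
            \<le> L * (real (card A) powr (1 - \<beta>) + real (card ?D) powr (1 - \<beta>))"
          using L by (rule mult_left_mono)
        moreover have "L * ((1 + \<delta> * (2 powr \<beta> - 1)) * real (card W) powr (1 - \<beta>))
            = L * real (card W) powr (1 - \<beta>) + 2 * (C * real (card W) powr (1 - \<beta>))"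
        proof -
          have "L * (\<delta> * (2 powr \<beta> - 1)) = 2 * C"
            unfolding L_def using g by (intro nonzero_eq_divide_eq[THEN iffD1]) auto
          then show ?thesis by (simp add: distrib_left distrib_right mult.assoc[symmetric])
        qed
        \<comment> \<open>\<open>L\<close> is chosen so that the growth of the potential is exactly
          twice the bound on the cut, matching the factor 2 of
          \<open>card_crossing_append\<close>.\<close>
        ultimately have gain: "L * real (card W) powr (1 - \<beta>) + 2 * card (cut E A ?D)
            \<le> L * (real (card A) powr (1 - \<beta>) + real (card ?D) powr (1 - \<beta>))"
          using A(4) by linarith
        have "real (card (crossing E (sa @ sd)))
            \<le> card (crossing E sa) + card (crossing E sd) + 2 * card (cut E A ?D)"
          using card_crossing_append[OF \<open>symp E\<close>, of sa sd] as ds sa(1) sd(1)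
          by (metis of_nat_le_iff)
        then have "card (crossing E (sa @ sd)) + L * real (card W) powr (1 - \<beta>)
            \<le> K * card A / k powr \<beta> + K * card ?D / k powr \<beta>"
          using wa wd gain pos by (simp add: algebra_simps)
        also have "\<dots> = K * card W / k powr \<beta>"
          by (simp add: cW[symmetric] add_divide_distrib distrib_left)
        finally show ?thesis
          using len sa sd False by (intro exI[of _ "sa @ sd"]) auto
      qed
      then show ?thesis using as ds A by (intro exI[of _ "as @ ds"]) auto
    qed
  qed
  then obtain vs where vs: "distinct vs" "set vs = V"
    and vs': "\<And>k. k \<ge> 1 \<Longrightarrow> \<exists>ss. concat ss = vs \<and> (\<forall>s\<in>set ss. length s \<le> k) \<and>
        ?good (real (card V)) k ss"
    by blast
  have "\<exists>ss. concat ss = vs \<and> (\<forall>s\<in>set ss. length s \<le> k) \<and>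
       length ss \<le> 1 + card V / (\<delta> * k) \<and> card (crossing E ss) \<le> K * card V / k powr \<beta>"
    if k: "k \<ge> 1" for k :: nat
  proof -
    obtain ss where ss: "concat ss = vs" "\<forall>s\<in>set ss. length s \<le> k" "?good (real (card V)) k ss"
      using vs'[OF k] by blast
    \<comment> \<open>The potential is now dropped; the summand 1 in the number of segments covers
      the case that \<open>V\<close> fits into a single one.\<close>
    have "0 \<le> L * real (card V) powr (1 - \<beta>)" "0 \<le> K * card V / k powr \<beta>" "0 \<le> card V / (\<delta> * k)"
      using L K \<delta> by auto
    then show ?thesis using ss by (intro exI[of _ ss]) force
  qed
  then show ?thesis using vs by blast
qed

subsection \<open>Packing in well-shaped meshes\<close>

text \<open>Every enclosing ball has at least half the distance as its radius. Boundedness ensures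
  that the infimum is taken over a nonempty set.\<close>

lemma dist_le_twice_enclosing_radius:
  assumes "bounded K" "x \<in> K" "y \<in> K"
  shows "dist x y \<le> 2 * enclosing_radius K"
proof -
  obtain a r where "K \<subseteq> cball a r"
    using assms(1) bounded_subset_cball by blast
  then have "{r. \<exists>z. K \<subseteq> cball z r} \<noteq> {}" by auto
  moreover have "dist x y / 2 \<le> r" if "K \<subseteq> cball z r" for z r
    using that assms(2,3) dist_triangle2[of x y z]
    by (auto simp: subset_iff mem_cball dist_commute) (smt (verit) dist_commute field_sum_of_halves)
  ultimately have "dist x y / 2 \<le> enclosing_radius K"
    unfolding enclosing_radius_def by (intro cInf_greatest) auto
  then show ?thesis by simp
qed

text \<open>The enclosing radius is at least half the diameter, so the aspect ratio forces the
  inscribed radius up to \<open>diameter / (2 * \<alpha>)\<close>. Halving this once more yields an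
  actual ball without asking whether the supremum is attained.\<close>

lemma fat_ball_in_simplex:
  fixes S :: "(real^'n) set"
  assumes S: "is_d_simplex S" and \<alpha>: "aspect_ratio (convex hull S) \<le> \<alpha>"
    and pq: "p \<in> S" "q \<in> S" "p \<noteq> q"
  shows "\<exists>c. ball c (diameter (convex hull S) / (4 * \<alpha>)) \<subseteq> convex hull S \<and> 0 < \<alpha>"
proof -
  let ?K = "convex hull S" and ?R = "{r. \<exists>x. cball x r \<subseteq> convex hull S}"
  have fin: "finite S" using S by (simp add: is_d_simplex_def)
  have bK: "bounded ?K" using fin by (simp add: bounded_convex_hull finite_imp_bounded)
  have pK: "p \<in> ?K" "q \<in> ?K" using pq by (auto simp: hull_inc)
  have "interior ?K \<noteq> {}"
    using S by (simp add: is_d_simplex_def interior_convex_hull_eq_empty)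
  then obtain x e where e: "0 < e" "cball x e \<subseteq> ?K"
    by (meson all_not_in_conv mem_interior_cball)
  \<comment> \<open>Negative radii also lie in \<open>?R\<close>, because their balls are empty; the
    diameter, being nonnegative, bounds them too.\<close>
  have bdd: "bdd_above ?R"
  proof (rule bdd_aboveI)
    fix r assume "r \<in> ?R"
    then obtain y where y: "cball y r \<subseteq> ?K" by auto
    have "diameter (cball y r) \<le> diameter ?K"
      by (rule diameter_subset[OF y bK])
    then show "r \<le> diameter ?K"
      using diameter_ge_0[OF bK] by (auto split: if_splits)
  qed
  have ir: "0 < inscribed_radius ?K"
    unfolding inscribed_radius_def using e bdd by (intro less_le_trans[OF e(1) cSup_upper]) auto
  have er: "diameter ?K / 2 \<le> enclosing_radius ?K"
  proof -
    have "diameter ?K \<le> 2 * enclosing_radius ?K"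
      using pK by (intro diameter_le) (auto intro: dist_le_twice_enclosing_radius[OF bK] simp flip: dist_norm)
    then show ?thesis by simp
  qed
  have D: "0 < diameter ?K"
    using diameter_bounded_bound[OF bK pK] pq(3) zero_less_dist_iff[of p q] by linarith
  have "enclosing_radius ?K \<le> \<alpha> * inscribed_radius ?K"
    using \<alpha> ir by (simp add: aspect_ratio_def divide_le_eq)
  then have le: "diameter ?K / 2 \<le> \<alpha> * inscribed_radius ?K" using er by linarith
  then have "0 < \<alpha> * inscribed_radius ?K" using D by linarith
  then have a0: "0 < \<alpha>" using ir by (simp add: zero_less_mult_iff)
  have "diameter ?K / (4 * \<alpha>) < diameter ?K / (2 * \<alpha>)"
    using a0 D by (simp add: divide_strict_left_mono)
  also have "\<dots> \<le> inscribed_radius ?K"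
    using le a0 by (simp add: field_simps)
  finally have "diameter ?K / (4 * \<alpha>) < Sup ?R"
    unfolding inscribed_radius_def .
  moreover have "?R \<noteq> {}" using e by blast
  ultimately obtain r where "r \<in> ?R" "diameter ?K / (4 * \<alpha>) < r"
    using less_cSupE by blast
  then obtain c where "cball c r \<subseteq> ?K" "diameter ?K / (4 * \<alpha>) < r" by auto
  moreover have "ball c (diameter ?K / (4 * \<alpha>)) \<subseteq> cball c r"
    using calculation(2) by auto
  ultimately show ?thesis using a0 by blast
qed

text \<open>Shrinking the simplex towards \<open>p\<close> makes long edges harmless.\<close>

lemma fat_ball_near_vertex:
  fixes S :: "(real^'n) set"
  assumes S: "is_d_simplex S" and \<alpha>: "aspect_ratio (convex hull S) \<le> \<alpha>"
    and pq: "p \<in> S" "q \<in> S" and t: "0 < t" "t \<le> dist p q"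
  shows "\<exists>c. ball c (t / (4 * \<alpha>)) \<subseteq> convex hull S \<inter> cball p t"
proof -
  let ?K = "convex hull S"
  let ?D = "diameter ?K"
  have bK: "bounded ?K"
    using S by (simp add: is_d_simplex_def bounded_convex_hull finite_imp_bounded)
  have pK: "p \<in> ?K" "q \<in> ?K" using pq by (auto simp: hull_inc)
  have "p \<noteq> q" using t by auto
  then obtain c where c: "ball c (?D / (4 * \<alpha>)) \<subseteq> ?K" and a0: "0 < \<alpha>"
    using fat_ball_in_simplex[OF S \<alpha> pq] by blast
  have tD: "t \<le> ?D" using diameter_bounded_bound[OF bK pK] t by linarith
  then have D: "0 < ?D" using t by linarith
  \<comment> \<open>The homothety with centre \<open>p\<close> and ratio
    \<open>t / ?D \<le> 1\<close> maps the simplex into itself and, as \<open>?D\<close> is its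
    diameter, into \<open>cball p t\<close>. The fat ball is scaled to radius
    \<open>t / (4 * \<alpha>)\<close>.\<close>
  let ?c = "p + (t / ?D) *\<^sub>R (c - p)"
  have "ball ?c (t / (4 * \<alpha>)) \<subseteq> ?K \<inter> cball p t"
  proof
    fix y assume y: "y \<in> ball ?c (t / (4 * \<alpha>))"
    define x where "x = p + (?D / t) *\<^sub>R (y - p)"
    have yx: "y = p + (t / ?D) *\<^sub>R (x - p)"
      using t D by (simp add: x_def)
    have "dist ?c y = (t / ?D) * dist c x"
    proof -
      have "?c - y = (t / ?D) *\<^sub>R (c - x)"
        by (subst yx) (simp add: algebra_simps)
      then show ?thesis using t D by (simp add: dist_norm)
    qed
    then have "(t / ?D) * dist c x < t / (4 * \<alpha>)" using y by simp
    then have "dist c x < ?D / (4 * \<alpha>)" using t D a0 by (simp add: field_simps)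
    then have x: "x \<in> ?K" using c by auto
    have "y = (1 - t / ?D) *\<^sub>R p + (t / ?D) *\<^sub>R x"
      by (subst yx) (simp add: algebra_simps)
    then have "y \<in> ?K"
      using convexD_alt[OF convex_convex_hull pK(1) x, of "t / ?D"] t tD D by simp
    moreover have "dist p y = (t / ?D) * dist p x"
      by (subst yx) (use t D in \<open>simp add: dist_norm norm_minus_commute\<close>)
    then have "dist p y \<le> (t / ?D) * ?D"
      using mult_left_mono[OF diameter_bounded_bound[OF bK pK(1) x], of "t / ?D"] t D by simp
    ultimately show "y \<in> ?K \<inter> cball p t" using D by simp
  qed
  then show ?thesis by blast
qed

lemma ball_packing:
  fixes c :: "'i \<Rightarrow> 'a::euclidean_space"
  assumes "finite I" and "\<And>i. i \<in> I \<Longrightarrow> 0 \<le> r i" and "0 \<le> R"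
    and sub: "\<And>i. i \<in> I \<Longrightarrow> ball (c i) (r i) \<subseteq> cball x R"
    and disj: "pairwise (\<lambda>i j. disjnt (ball (c i) (r i)) (ball (c j) (r j))) I"
  shows "(\<Sum>i\<in>I. r i ^ DIM('a)) \<le> R ^ DIM('a)"
proof -
  let ?v = "unit_ball_vol (real DIM('a))"
  have "?v * (\<Sum>i\<in>I. r i ^ DIM('a)) = (\<Sum>i\<in>I. measure lebesgue (ball (c i) (r i)))"
    using assms(2) by (simp add: content_ball sum_distrib_left)
  also have "\<dots> = measure lebesgue (\<Union>i\<in>I. ball (c i) (r i))"
    using assms(1) disj by (intro measure_UNION'[symmetric]) auto
  also have "\<dots> \<le> measure lebesgue (cball x R)"
    using sub assms(1) by (intro measure_mono_fmeasurable) auto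
  also have "\<dots> = ?v * R ^ DIM('a)"
    using assms(3) by (simp add: content_cball)
  finally show ?thesis by simp
qed

text \<open>Each edge is charged to one simplex containing it, so a simplex receives at most
  \<open>(d + 1)^2\<close> ordered pairs. The largest truncated length among them yields a ball
  inside that simplex, and balls of different simplices are disjoint. All lie within
  \<open>3 * \<rho>\<close> of \<open>x\<close>; with the fatness \<open>1 / (4 * \<alpha>)\<close>
  this gives the factor 12.\<close>

lemma sum_mesh_edges_le:
  fixes T :: "(real^'n) set set"
  assumes T: "well_shaped_mesh \<alpha> T" and \<alpha>: "0 < \<alpha>" and \<rho>: "0 < \<rho>" and "finite P"
    and P: "\<And>p q. (p, q) \<in> P \<Longrightarrow> mesh_adj T p q \<and> p \<in> cball x (2 * \<rho>)"
  shows "(\<Sum>(p, q)\<in>P. min \<rho> (dist p q) ^ CARD('n))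
           \<le> (real CARD('n) + 1)\<^sup>2 * (12 * \<alpha> * \<rho>) ^ CARD('n)"
proof -
  let ?d = "CARD('n)"
  define t :: "(real^'n) \<times> (real^'n) \<Rightarrow> real" where "t = (\<lambda>(p, q). min \<rho> (dist p q))"
  have "\<exists>S. S \<in> T \<and> fst e \<in> S \<and> snd e \<in> S" if "e \<in> P" for e
    using P[of "fst e" "snd e"] that by (auto simp: mesh_adj_def)
  then obtain s where s: "\<And>e. e \<in> P \<Longrightarrow> s e \<in> T \<and> fst e \<in> s e \<and> snd e \<in> s e"
    by metis
  have t0: "0 < t e" if "e \<in> P" for e
    using P[of "fst e" "snd e"] that \<rho> by (auto simp: t_def case_prod_unfold mesh_adj_def)
  define F where "F = s ` P"
  have finF: "finite F" and FT: "F \<subseteq> T" using \<open>finite P\<close> s by (auto simp: F_def)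
  have simp_T: "is_d_simplex S" "aspect_ratio (convex hull S) \<le> \<alpha>" if "S \<in> T" for S
    using T that by (auto simp: well_shaped_mesh_def)
  define P' where "P' = (\<lambda>S. {e \<in> P. s e = S})"
  have "\<exists>e. e \<in> P' S \<and> (\<forall>e'\<in>P' S. t e' \<le> t e)" if "S \<in> F" for S
  proof -
    have *: "finite (P' S)" "P' S \<noteq> {}"
      using that \<open>finite P\<close> by (auto simp: P'_def F_def)
    then have "Max (t ` P' S) \<in> t ` P' S" by (intro Max_in) auto
    then obtain e where "e \<in> P' S" "t e = Max (t ` P' S)" by (metis imageE)
    then show ?thesis using * by (intro exI[of _ e]) auto
  qed
  \<comment> \<open>\<open>b S\<close> is an edge charged to \<open>S\<close> whose truncated length
    is maximal; it stands for all edges charged to \<open>S\<close>.\<close>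
  then obtain b where b: "\<And>S. S \<in> F \<Longrightarrow> b S \<in> P' S \<and> (\<forall>e'\<in>P' S. t e' \<le> t (b S))"
    by metis
  have bP: "b S \<in> P" "s (b S) = S" "S \<in> T" if "S \<in> F" for S
    using b[OF that] that FT by (auto simp: P'_def)
  have "\<exists>c. ball c (t (b S) / (4 * \<alpha>)) \<subseteq> convex hull S \<inter> cball (fst (b S)) (t (b S))"
    if "S \<in> F" for S
    using bP[OF that] s[of "b S"] t0[of "b S"]
    by (intro fat_ball_near_vertex[where q = "snd (b S)"] simp_T)
       (auto simp: t_def case_prod_unfold)
  then obtain c where c: "\<And>S. S \<in> F \<Longrightarrow>
      ball (c S) (t (b S) / (4 * \<alpha>)) \<subseteq> convex hull S \<inter> cball (fst (b S)) (t (b S))"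
    by metis
  have "(\<Sum>S\<in>F. (t (b S) / (4 * \<alpha>)) ^ DIM(real^'n)) \<le> (3 * \<rho>) ^ DIM(real^'n)"
  proof (rule ball_packing[where c = c and x = x])
    fix S assume S: "S \<in> F"
    show "0 \<le> t (b S) / (4 * \<alpha>)" using t0[OF bP(1)[OF S]] \<alpha> by simp
    have "t (b S) \<le> \<rho>" by (simp add: t_def case_prod_unfold)
    moreover have "dist x (fst (b S)) \<le> 2 * \<rho>"
      using P[of "fst (b S)" "snd (b S)"] bP(1)[OF S] by simp
    ultimately have "cball (fst (b S)) (t (b S)) \<subseteq> cball x (3 * \<rho>)"
      by (intro cball_subset_cball_iff[THEN iffD2] disjI1) (simp add: dist_commute)
    then show "ball (c S) (t (b S) / (4 * \<alpha>)) \<subseteq> cball x (3 * \<rho>)" using c[OF S] by blast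
  next
    show "pairwise (\<lambda>i j. disjnt (ball (c i) (t (b i) / (4 * \<alpha>))) (ball (c j) (t (b j) / (4 * \<alpha>)))) F"
    proof (rule pairwiseI)
      fix S S' assume S: "S \<in> F" "S' \<in> F" "S \<noteq> S'"
      \<comment> \<open>The balls are open, so they lie in the interiors of their simplices, and
        these are disjoint.\<close>
      have "ball (c S) (t (b S) / (4 * \<alpha>)) \<subseteq> interior (convex hull S)"
           "ball (c S') (t (b S') / (4 * \<alpha>)) \<subseteq> interior (convex hull S')"
        using c[OF S(1)] c[OF S(2)] by (simp_all add: interior_maximal)
      moreover have "interior (convex hull S) \<inter> interior (convex hull S') = {}"
        using T S FT unfolding well_shaped_mesh_def by blast
      ultimately show "disjnt (ball (c S) (t (b S) / (4 * \<alpha>))) (ball (c S') (t (b S') / (4 * \<alpha>)))"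
        unfolding disjnt_def by blast
    qed
  qed (use finF \<rho> in auto)
  then have "(\<Sum>S\<in>F. t (b S) ^ ?d) / (4 * \<alpha>) ^ ?d \<le> (3 * \<rho>) ^ ?d"
    by (simp add: power_divide sum_divide_distrib)
  then have "(\<Sum>S\<in>F. t (b S) ^ ?d) \<le> (3 * \<rho>) ^ ?d * (4 * \<alpha>) ^ ?d"
    using \<alpha> by (subst (asm) pos_divide_le_eq) auto
  also have "\<dots> = (12 * \<alpha> * \<rho>) ^ ?d"
    by (subst power_mult_distrib[symmetric]) (simp add: mult_ac)
  finally have main: "(\<Sum>S\<in>F. t (b S) ^ ?d) \<le> (12 * \<alpha> * \<rho>) ^ ?d" .
  have "(\<Sum>(p, q)\<in>P. min \<rho> (dist p q) ^ ?d) = (\<Sum>e\<in>P. t e ^ ?d)"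
    by (simp add: t_def case_prod_unfold)
  also have "\<dots> = (\<Sum>S\<in>F. \<Sum>e\<in>P' S. t e ^ ?d)"
    unfolding F_def P'_def by (rule sum.image_gen[OF \<open>finite P\<close>])
  also have "\<dots> \<le> (\<Sum>S\<in>F. (real ?d + 1)\<^sup>2 * t (b S) ^ ?d)"
  proof (rule sum_mono)
    fix S assume S: "S \<in> F"
    have card: "finite S" "card S = ?d + 1"
      using simp_T[OF bP(3)[OF S]] by (auto simp: is_d_simplex_def)
    have "P' S \<subseteq> S \<times> S" using s by (force simp: P'_def)
    then have "card (P' S) \<le> card (S \<times> S)" using card by (intro card_mono) auto
    also have "card (S \<times> S) = (?d + 1)\<^sup>2"
      using card by (simp only: card_cartesian_product power2_eq_square)
    finally have "real (card (P' S)) \<le> real ((?d + 1)\<^sup>2)" by (simp only: of_nat_le_iff)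
    then have cP: "real (card (P' S)) \<le> (real ?d + 1)\<^sup>2" by (simp add: add.commute)
    have "(\<Sum>e\<in>P' S. t e ^ ?d) \<le> real (card (P' S)) * t (b S) ^ ?d"
      using b[OF S] t0 by (intro sum_bounded_above power_mono) (auto simp: P'_def less_imp_le)
    also have "\<dots> \<le> (real ?d + 1)\<^sup>2 * t (b S) ^ ?d"
      using cP t0[OF bP(1)[OF S]] by (intro mult_right_mono) auto
    finally show "(\<Sum>e\<in>P' S. t e ^ ?d) \<le> (real ?d + 1)\<^sup>2 * t (b S) ^ ?d" .
  qed
  also have "\<dots> \<le> (real ?d + 1)\<^sup>2 * (12 * \<alpha> * \<rho>) ^ ?d"
    unfolding sum_distrib_left[symmetric] by (intro mult_left_mono main) simp
  finally show ?thesis .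
qed

section \<open>Finiteness and bounded degree\<close>

lemma finite_mesh_vertices:
  fixes T :: "(real^'n) set set"
  assumes "well_shaped_mesh \<alpha> T" shows "finite (mesh_vertices T)"
  using assms by (auto simp: well_shaped_mesh_def mesh_vertices_def is_d_simplex_def)

lemma mesh_adj_vertices: "mesh_adj T p q \<Longrightarrow> p \<in> mesh_vertices T \<and> q \<in> mesh_vertices T"
  by (auto simp: mesh_adj_def mesh_vertices_def)

lemma symp_mesh_adj: "symp (mesh_adj T)"
  by (auto simp: symp_def mesh_adj_def)

text \<open>The packing constant with \<open>\<rho> ^ d\<close> divided out; it serves both as
  degree bound and in the separator size. The \<open>itself\<close> argument only carries the
  dimension.\<close>

definition degree_bound :: "'n itself \<Rightarrow> real \<Rightarrow> real" where
  "degree_bound _ \<alpha> = (real CARD('n) + 1)\<^sup>2 * (12 * \<alpha>) ^ CARD('n)"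

text \<open>Take \<open>\<rho>\<close> to be the length of a shortest edge at \<open>p\<close>.
  Every truncated length then equals \<open>\<rho>\<close>, and \<open>\<rho> ^ d\<close> cancels
  from the packing inequality.\<close>

lemma mesh_degree_le:
  fixes T :: "(real^'n) set set"
  assumes T: "well_shaped_mesh \<alpha> T" and \<alpha>: "0 < \<alpha>"
  shows "card {q. mesh_adj T p q} \<le> degree_bound TYPE('n) \<alpha>"
proof (cases "{q. mesh_adj T p q} = {}")
  case True
  then show ?thesis using \<alpha> by (simp add: degree_bound_def)
next
  case False
  let ?N = "{q. mesh_adj T p q}"
  have fin: "finite ?N"
    by (rule finite_subset[OF _ finite_mesh_vertices[OF T]]) (auto dest: mesh_adj_vertices)
  define \<rho> where "\<rho> = Min (dist p ` ?N)"
  have "\<forall>q\<in>?N. 0 < dist p q" by (auto simp: mesh_adj_def)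
  then have \<rho>0: "0 < \<rho>" unfolding \<rho>_def using fin False
    by (subst Min_gr_iff) (blast intro: finite_imageI)+
  have \<rho>: "min \<rho> (dist p q) = \<rho>" if "q \<in> ?N" for q
    unfolding \<rho>_def using fin that by (intro min_absorb1 Min_le) auto
  have "(\<Sum>(p, q)\<in>{p} \<times> ?N. min \<rho> (dist p q) ^ CARD('n))
      \<le> (real CARD('n) + 1)\<^sup>2 * (12 * \<alpha> * \<rho>) ^ CARD('n)"
    using fin \<rho>0 by (intro sum_mesh_edges_le[OF T \<alpha>, where x = p]) auto
  also have "(\<Sum>(p, q)\<in>{p} \<times> ?N. min \<rho> (dist p q) ^ CARD('n)) = card ?N * \<rho> ^ CARD('n)"
    using \<rho> by (simp add: sum.cartesian_product[symmetric])
  finally show ?thesis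
    using \<rho>0 by (simp add: degree_bound_def power_mult_distrib)
qed

subsection \<open>Sphere separators\<close>

text \<open>A radius minimising the number of crossed intervals does at least as well as the mean
  over the window. Integrating the count, each interval contributes the length of its intersection
  with the window.\<close>

lemma exists_radius_few_crossings:
  fixes a b :: "'e \<Rightarrow> real" and K :: real
  assumes "finite P" and "0 < \<rho>" and le: "(\<Sum>e\<in>P. min \<rho> \<bar>b e - a e\<bar>) \<le> \<rho> * K"
  shows "\<exists>r\<in>{u..u + \<rho>}. card {e \<in> P. a e \<le> r \<and> r < b e} \<le> K"
proof -
  let ?f = "\<lambda>r. card {e \<in> P. a e \<le> r \<and> r < b e}"
  obtain r where r: "r \<in> {u..u + \<rho>}" and min: "\<And>r'. r' \<in> {u..u + \<rho>} \<Longrightarrow> ?f r \<le> ?f r'"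
    using ex_has_least_nat[of "\<lambda>r. r \<in> {u..u + \<rho>}" u ?f] \<open>0 < \<rho>\<close> by auto
  let ?I = "\<lambda>e. {a e..<b e} \<inter> {u..u + \<rho>}"
  have fm: "?I e \<in> fmeasurable lborel" for e
    by (rule fmeasurableI2[of "{u..u + \<rho>}"]) (auto intro!: fmeasurableI simp: emeasure_lborel_Icc_eq)
  have "?f r * \<rho> = integral\<^sup>L lborel (\<lambda>x. ?f r * (indicator {u..u + \<rho>} x :: real))"
    using \<open>0 < \<rho>\<close> by simp
  also have "\<dots> \<le> integral\<^sup>L lborel (\<lambda>x. \<Sum>e\<in>P. indicator (?I e) x :: real)"
  proof (rule integral_mono)
    show "integrable lborel (\<lambda>x. \<Sum>e\<in>P. indicator (?I e) x :: real)"
      using fm by (intro Bochner_Integration.integrable_sum) (auto simp: fmeasurable_def)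
    fix x
    show "?f r * (indicator {u..u + \<rho>} x :: real) \<le> (\<Sum>e\<in>P. indicator (?I e) x :: real)"
    proof (cases "x \<in> {u..u + \<rho>}")
      case True
      have "(\<Sum>e\<in>P. indicator (?I e) x :: real) = (\<Sum>e\<in>P. if a e \<le> x \<and> x < b e then 1 else 0)"
        using True by (intro sum.cong) (auto simp: indicator_def)
      also have "\<dots> = ?f x"
        using \<open>finite P\<close> by (simp add: sum.If_cases Int_def)
      finally show ?thesis using min[OF True] True by simp
    qed (simp add: sum_nonneg)
  qed (auto intro!: integrable_real_indicator simp: emeasure_lborel_Icc_eq)
  also have "\<dots> = (\<Sum>e\<in>P. measure lborel (?I e))"
    using fm by (subst Bochner_Integration.integral_sum) (auto simp: fmeasurable_def)
  also have "\<dots> \<le> (\<Sum>e\<in>P. min \<rho> \<bar>b e - a e\<bar>)"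
  proof (rule sum_mono)
    fix e assume "e \<in> P"
    have "measure lborel (?I e) \<le> measure lborel {u..u + \<rho>}"
      by (intro measure_mono_fmeasurable) (auto intro!: fmeasurableI simp: emeasure_lborel_Icc_eq)
    moreover have "measure lborel (?I e) \<le> measure lborel {a e..b e}"
      by (intro measure_mono_fmeasurable) (auto intro!: fmeasurableI simp: emeasure_lborel_Icc_eq)
    moreover have "measure lborel {a e..b e} \<le> \<bar>b e - a e\<bar>"
      by (cases "a e \<le> b e") auto
    ultimately show "measure lborel (?I e) \<le> min \<rho> \<bar>b e - a e\<bar>"
      using \<open>0 < \<rho>\<close> by simp
  qed
  also note le
  finally have "?f r * \<rho> \<le> K * \<rho>" by (simp add: mult.commute)
  then have "?f r \<le> K" using \<open>0 < \<rho>\<close> by simp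
  then show ?thesis using r by blast
qed

text \<open>Lengths up to \<open>h\<close> are paid by the summand \<open>h\<close>; beyond
  \<open>h\<close> the factor \<open>(t / h) ^ n\<close> is at least 1. This passes from lengths,
  which govern the cut, to their \<open>d\<close>-th powers, which volume controls.\<close>

lemma min_le_power_plus:
  fixes t h :: real
  assumes "0 \<le> t" "0 < h"
  shows "t \<le> t ^ Suc n / h ^ n + h"
proof (cases "t \<le> h")
  case True
  then show ?thesis using assms by (simp add: add_increasing)
next
  case False
  then have "h ^ n \<le> t ^ n" using assms by (intro power_mono) auto
  then have "t * h ^ n \<le> t * t ^ n" using assms by (intro mult_left_mono) auto
  then have "t \<le> t ^ Suc n / h ^ n" using assms by (simp add: le_divide_eq)
  then show ?thesis using assms by simp
qed

text \<open>The value of \<open>\<delta>\<close> is chosen so that \<open>card N\<close> sets, each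
  holding at most a fraction \<open>\<delta>\<close> of \<open>W\<close>, together hold at most half
  of it.\<close>

lemma mesh_separator:
  fixes T :: "(real^'n) set set" and \<delta> :: real
  assumes T: "well_shaped_mesh \<alpha> T" and \<alpha>: "0 < \<alpha>"
    and cover: "cball (0::real^'n) 2 \<subseteq> (\<Union>x\<in>N. ball x (1/2))" "finite N"
    and W: "W \<subseteq> mesh_vertices T" "2 \<le> card W"
  defines "\<delta> \<equiv> 1 / (2 * real (card N))"
  shows "\<exists>A\<subseteq>W. \<delta> * card W \<le> card A \<and> \<delta> * card W \<le> card (W - A) \<and>
     card (cut (mesh_adj T) A (W - A))
       \<le> 2 * degree_bound TYPE('n) \<alpha> * card W powr (1 - 1 / CARD('n))"
proof -
  let ?d = "CARD('n)" and ?m = "card W"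
  let ?\<Delta> = "degree_bound TYPE('n) \<alpha>"
  have finV: "finite (mesh_vertices T)" by (rule finite_mesh_vertices[OF T])
  then have finW: "finite W" using W(1) finite_subset by blast
  have finN: "finite {q. mesh_adj T p q}" for p
    by (rule finite_subset[OF _ finV]) (auto dest: mesh_adj_vertices)
  have "N \<noteq> {}" using cover(1) by (metis UN_empty centre_in_cball empty_iff subset_iff zero_le_numeral)
  then have cN: "1 \<le> card N" using cover(2) by (simp add: Suc_le_eq card_gt_0_iff)
  then have \<delta>: "0 < \<delta>" "\<delta> \<le> 1 / 2" "real (card N) * \<delta> = 1 / 2" unfolding \<delta>_def by auto
  have \<Delta>: "0 \<le> ?\<Delta>" using \<alpha> by (simp add: degree_bound_def)
  have m1: "1 \<le> real ?m powr (1 - 1 / ?d)" using W(2) by (intro ge_one_powr_ge_zero) auto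
  show ?thesis
  proof (cases "\<delta> * ?m \<le> 1")
    case True
    \<comment> \<open>With \<open>\<delta> * card W \<le> 1\<close> a single vertex is already a
      balanced side, and its degree bounds the cut. The remaining case has
      \<open>\<delta> * card W > 1\<close>, which keeps the radius below positive.\<close>
    obtain p where p: "p \<in> W" using W(2) by fastforce
    have "cut (mesh_adj T) {p} (W - {p}) \<subseteq> Pair p ` {q. mesh_adj T p q}"
      by (auto simp: cut_def)
    then have "card (cut (mesh_adj T) {p} (W - {p})) \<le> card {q. mesh_adj T p q}"
      by (meson finN surj_card_le)
    then have "card (cut (mesh_adj T) {p} (W - {p})) \<le> ?\<Delta>"
      using mesh_degree_le[OF T \<alpha>, of p] by linarith
    also have "\<dots> \<le> 2 * ?\<Delta> * real ?m powr (1 - 1 / ?d)"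
      using \<Delta> m1 by (smt (verit) mult_le_cancel_left1)
    finally show ?thesis
      using True p W(2) finW by (intro exI[of _ "{p}"]) auto
  next
    case False
    \<comment> \<open>A smallest ball can be sought among those with a vertex of \<open>W\<close> on
      the boundary: radii become distances of pairs, and the minimum over finitely many pairs is
      attained.\<close>
    define heavy where "heavy = (\<lambda>(p, q). p \<in> W \<and> q \<in> W \<and> \<delta> * ?m \<le> card (W \<inter> cball p (dist p q)))"
    have far: "\<exists>q\<in>S. S \<subseteq> cball p (dist p q)" if "finite S" "S \<noteq> {}" for p and S :: "(real^'n) set"
    proof -
      have "Max (dist p ` S) \<in> dist p ` S" using that by (intro Max_in) auto
      then obtain q where "q \<in> S" "dist p q = Max (dist p ` S)" by (metis imageE)
      then show ?thesis using that(1) by (intro bexI[of _ q]) auto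
    qed
    have "W \<noteq> {}" using W(2) by auto
    then obtain p0 q0 where "p0 \<in> W" "q0 \<in> W" "W \<subseteq> cball p0 (dist p0 q0)"
      using far[OF finW] by blast
    moreover from this have "W \<inter> cball p0 (dist p0 q0) = W" by blast
    moreover have "\<delta> * ?m \<le> ?m" using \<delta> by (simp add: mult_left_le_one_le)
    ultimately have ne: "heavy (p0, q0)" by (simp add: heavy_def)
    have "finite (Collect heavy)"
      by (rule finite_subset[of _ "W \<times> W"]) (use finW in \<open>auto simp: heavy_def\<close>)
    then have "Min ((\<lambda>(p, q). dist p q) ` Collect heavy) \<in> (\<lambda>(p, q). dist p q) ` Collect heavy"
      using ne by (intro Min_in) auto
    then obtain x y where xy: "heavy (x, y)"
        "dist x y = Min ((\<lambda>(p, q). dist p q) ` Collect heavy)" by auto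
    define \<rho> where "\<rho> = dist x y"
    have least: "\<rho> \<le> dist p q" if "heavy (p, q)" for p q
      unfolding \<rho>_def xy(2) using that \<open>finite (Collect heavy)\<close> by (intro Min_le) force+
    \<comment> \<open>A ball of radius 0 contains one vertex only, fewer than
      \<open>\<delta> * card W\<close>.\<close>
    have \<rho>: "0 < \<rho>"
    proof (rule ccontr)
      assume "\<not> 0 < \<rho>"
      then have "x = y" by (simp add: \<rho>_def)
      then have "W \<inter> cball x (dist x y) = {x}" using xy(1) by (auto simp: heavy_def)
      then show False using xy(1) False by (simp add: heavy_def)
    qed
    \<comment> \<open>Around any vertex of \<open>W\<close> in \<open>D\<close>, the ball reaching
      the farthest such vertex contains all of \<open>W \<inter> D\<close> and has radius below
      \<open>\<rho>\<close>, so minimality makes it not heavy.\<close>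
    have light: "card (W \<inter> D) \<le> \<delta> * ?m" if D: "\<And>u v. u \<in> D \<Longrightarrow> v \<in> D \<Longrightarrow> dist u v < \<rho>" for D
    proof (cases "W \<inter> D = {}")
      case True
      then show ?thesis using \<delta> by simp
    next
      case nonempty: False
      then obtain p where p: "p \<in> W" "p \<in> D" by blast
      obtain q where q: "q \<in> W \<inter> D" "W \<inter> D \<subseteq> cball p (dist p q)"
        using far[OF _ nonempty] finW by blast
      then have "card (W \<inter> D) \<le> card (W \<inter> cball p (dist p q))"
        using finW by (intro card_mono) auto
      moreover have "\<not> heavy (p, q)" using least[of p q] D[of p q] p q by force
      ultimately show ?thesis using p q by (auto simp: heavy_def)
    qed
    \<comment> \<open>A sphere about \<open>x\<close> of radius at most \<open>2 * \<rho>\<close>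
      can only cut edges whose inner endpoint is in \<open>cball x (2 * \<rho>)\<close>.\<close>
    define P where "P = {(p, q) \<in> W \<times> W. mesh_adj T p q \<and> p \<in> cball x (2 * \<rho>)}"
    have finP: "finite P"
      by (rule finite_subset[of _ "W \<times> W"]) (use finW in \<open>auto simp: P_def\<close>)
    have cP: "card P \<le> ?\<Delta> * ?m"
    proof -
      have "card P \<le> card (SIGMA p:W. {q. mesh_adj T p q})"
        using finW finN by (intro card_mono finite_SigmaI) (auto simp: P_def)
      also have "\<dots> = (\<Sum>p\<in>W. card {q. mesh_adj T p q})"
        using finW finN by simp
      finally have "real (card P) \<le> (\<Sum>p\<in>W. real (card {q. mesh_adj T p q}))"
        by (metis of_nat_le_iff of_nat_sum)
      also have "\<dots> \<le> ?m * ?\<Delta>"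
        by (rule sum_bounded_above) (rule mesh_degree_le[OF T \<alpha>])
      finally show ?thesis by (simp add: mult.commute)
    qed
    define t where "t = (\<lambda>(p, q). min \<rho> (dist (p::real^'n) q))"
    have t0: "0 \<le> t e" for e using \<rho> by (auto simp: t_def case_prod_unfold)
    \<comment> \<open>Edges shorter than \<open>h\<close> contribute at most \<open>h\<close> each to the expected cut, longer ones
      are paid for by the volume near them; this \<open>h\<close> balances the two.\<close>
    define h where "h = \<rho> * ?m powr (- 1 / ?d)"
    have m0: "0 < real ?m" using W(2) by simp
    have h: "0 < h" using \<rho> m0 by (simp add: h_def)
    obtain n where n: "?d = Suc n" using not0_implies_Suc[of ?d] by auto
    have mpow: "?m * ?m powr (- 1 / ?d) = ?m powr (1 - 1 / ?d)"
      using m0 by (simp add: powr_diff powr_minus divide_inverse)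
    have hn: "\<rho> ^ ?d / h ^ n = \<rho> * ?m powr (1 - 1 / ?d)"
    proof -
      have "(real ?m powr (- 1 / ?d)) ^ n = ?m powr (- real n / ?d)"
        using m0 by (simp add: powr_realpow[symmetric] powr_powr)
      also have "- real n / ?d = - (1 - 1 / ?d)"
        using n by (simp add: field_simps)
      finally have "h ^ n = \<rho> ^ n * ?m powr - (1 - 1 / ?d)"
        by (simp add: h_def power_mult_distrib)
      then show ?thesis using \<rho> n by (simp add: powr_minus field_simps)
    qed
    have "(\<Sum>e\<in>P. t e) \<le> (\<Sum>e\<in>P. t e ^ ?d / h ^ n + h)"
      using t0 h n by (intro sum_mono) (metis min_le_power_plus)
    also have "\<dots> = (\<Sum>(p, q)\<in>P. min \<rho> (dist p q) ^ ?d) / h ^ n + card P * h"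
      by (simp add: sum.distrib sum_divide_distrib t_def case_prod_unfold)
    also have "\<dots> \<le> ?\<Delta> * \<rho> ^ ?d / h ^ n + (?\<Delta> * ?m) * h"
    proof (intro add_mono divide_right_mono mult_right_mono cP)
      show "(\<Sum>(p, q)\<in>P. min \<rho> (dist p q) ^ ?d) \<le> ?\<Delta> * \<rho> ^ ?d"
        using sum_mesh_edges_le[OF T \<alpha> \<rho> finP, of x]
        by (auto simp: P_def degree_bound_def power_mult_distrib mult_ac)
    qed (use h in auto)
    \<comment> \<open>By the choice of \<open>h\<close> both summands are equal; hence the factor
      2.\<close>
    also have "\<dots> = \<rho> * (2 * ?\<Delta> * ?m powr (1 - 1 / ?d))"
    proof -
      have "?\<Delta> * \<rho> ^ ?d / h ^ n = ?\<Delta> * (\<rho> * ?m powr (1 - 1 / ?d))"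
        using hn by (metis times_divide_eq_right)
      moreover have "(?\<Delta> * ?m) * h = ?\<Delta> * \<rho> * (?m * ?m powr (- 1 / ?d))"
        by (simp add: h_def)
      ultimately show ?thesis unfolding mpow by simp
    qed
    finally have sum_t: "(\<Sum>e\<in>P. t e) \<le> \<rho> * (2 * ?\<Delta> * ?m powr (1 - 1 / ?d))" .
    have "(\<Sum>e\<in>P. min \<rho> \<bar>dist x (snd e) - dist x (fst e)\<bar>) \<le> (\<Sum>e\<in>P. t e)"
    proof (rule sum_mono)
      fix e
      have "\<bar>dist x (snd e) - dist x (fst e)\<bar> \<le> dist (fst e) (snd e)"
        by (metis abs_dist_diff_le dist_commute)
      then show "min \<rho> \<bar>dist x (snd e) - dist x (fst e)\<bar> \<le> t e"
        by (auto simp: t_def case_prod_unfold)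
    qed
    with sum_t have "(\<Sum>e\<in>P. min \<rho> \<bar>dist x (snd e) - dist x (fst e)\<bar>)
        \<le> \<rho> * (2 * ?\<Delta> * ?m powr (1 - 1 / ?d))" by linarith
    from exists_radius_few_crossings[OF finP \<rho> this, of \<rho>]
    obtain r where r: "\<rho> \<le> r" "r \<le> 2 * \<rho>"
      and cut_r: "card {e \<in> P. dist x (fst e) \<le> r \<and> r < dist x (snd e)}
                   \<le> 2 * ?\<Delta> * ?m powr (1 - 1 / ?d)" by auto
    define A where "A = W \<inter> cball x r"
    have "\<delta> * ?m \<le> card (W \<inter> cball x \<rho>)" using xy(1) by (simp add: heavy_def \<rho>_def)
    also have "\<dots> \<le> card A"
      unfolding A_def using finW r by (intro of_nat_mono card_mono) auto
    finally have A1: "\<delta> * ?m \<le> card A" .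
    \<comment> \<open>The cover of the ball of radius 2, scaled by \<open>\<rho>\<close> and moved
      to \<open>x\<close>, covers \<open>A\<close> by sets in which all distances are below
      \<open>\<rho>\<close>, so each of them is light.\<close>
    have "A \<subseteq> (\<Union>z\<in>N. W \<inter> (\<lambda>v. x + \<rho> *\<^sub>R v) ` ball z (1/2))"
    proof
      fix a assume a: "a \<in> A"
      then have "dist x a \<le> 2 * \<rho>" using r by (auto simp: A_def)
      then have "(1 / \<rho>) *\<^sub>R (a - x) \<in> cball 0 2"
        using \<rho> by (simp add: dist_norm norm_minus_commute divide_le_eq del: scaleR_right_diff_distrib)
      then obtain z where "z \<in> N" "(1 / \<rho>) *\<^sub>R (a - x) \<in> ball z (1/2)" using cover by blast
      moreover have "a = x + \<rho> *\<^sub>R ((1 / \<rho>) *\<^sub>R (a - x))" using \<rho> by simp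
      ultimately show "a \<in> (\<Union>z\<in>N. W \<inter> (\<lambda>v. x + \<rho> *\<^sub>R v) ` ball z (1/2))"
        using a unfolding A_def by blast
    qed
    then have "card A \<le> card (\<Union>z\<in>N. W \<inter> (\<lambda>v. x + \<rho> *\<^sub>R v) ` ball z (1/2))"
      using finW cover(2) by (intro card_mono) auto
    also have "\<dots> \<le> (\<Sum>z\<in>N. card (W \<inter> (\<lambda>v. x + \<rho> *\<^sub>R v) ` ball z (1/2)))"
      by (rule card_UN_le[OF cover(2)])
    finally have "real (card A) \<le> (\<Sum>z\<in>N. real (card (W \<inter> (\<lambda>v. x + \<rho> *\<^sub>R v) ` ball z (1/2))))"
      by (metis of_nat_le_iff of_nat_sum)
    also have "\<dots> \<le> card N * (\<delta> * ?m)"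
    proof (rule sum_bounded_above, rule light)
      fix z u v :: "real^'n"
      assume "u \<in> (\<lambda>v. x + \<rho> *\<^sub>R v) ` ball z (1/2)" "v \<in> (\<lambda>v. x + \<rho> *\<^sub>R v) ` ball z (1/2)"
      then obtain u' v' where uv: "u = x + \<rho> *\<^sub>R u'" "v = x + \<rho> *\<^sub>R v'"
        "dist z u' < 1/2" "dist z v' < 1/2"
        unfolding image_iff Bex_def mem_ball by blast
      then have "dist u' v' < 1" using dist_triangle3[of u' v' z] by linarith
      moreover have "u - v = \<rho> *\<^sub>R (u' - v')" by (simp add: uv algebra_simps)
      then have "dist u v = \<rho> * dist u' v'" using \<rho> by (simp only: dist_norm norm_scaleR)
      ultimately show "dist u v < \<rho>" using \<rho> by simp
    qed
    also have "\<dots> = ?m / 2" using \<delta>(3) by (simp add: mult.assoc[symmetric])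
    finally have half: "card A \<le> real ?m / 2" .
    have "A \<subseteq> W" by (simp add: A_def)
    then have "card (W - A) = ?m - card A" "card A \<le> ?m"
      using finW by (auto intro: card_Diff_subset card_mono finite_subset)
    then have "card (W - A) = real ?m - card A" by (simp add: of_nat_diff)
    moreover have "\<delta> * ?m \<le> ?m / 2" using mult_right_mono[OF \<delta>(2), of ?m] by simp
    ultimately have A2: "\<delta> * ?m \<le> card (W - A)" using half by linarith
    have "cut (mesh_adj T) A (W - A) \<subseteq> {e \<in> P. dist x (fst e) \<le> r \<and> r < dist x (snd e)}"
      using r by (auto simp: cut_def A_def P_def)
    then have "card (cut (mesh_adj T) A (W - A)) \<le> card {e \<in> P. dist x (fst e) \<le> r \<and> r < dist x (snd e)}"
      using finP by (intro card_mono) auto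
    then show ?thesis using A1 A2 cut_r \<open>A \<subseteq> W\<close> by (intro exI[of _ A]) linarith
  qed
qed

subsection \<open>Segments in memory\<close>

lemma rec_start_Suc: "rec_start T vs (Suc i) = rec_start T vs i + rec_size T vs i"
  by (simp add: rec_start_def)

lemma rec_start_mono: "i \<le> j \<Longrightarrow> rec_start T vs i \<le> rec_start T vs j"
  by (induction j rule: dec_induct) (auto simp: rec_start_Suc)

lemma rec_start_less: "i < j \<Longrightarrow> rec_start T vs i < rec_start T vs j"
  using rec_start_mono[of "Suc i" j T vs] by (simp add: rec_start_Suc rec_size_def)

lemma length_filter_concat_map:
  "length (filter P (concat (map f xs))) = (\<Sum>x\<leftarrow>xs. length (filter P (f x)))"
  by (induction xs) auto

text \<open>\<open>P\<close> will mean that the word's block is outside the working set. The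
  vertex's own record lies in the memory range of its segment, so only reading the weight of a
  neighbour outside the segment can miss.\<close>

lemma vertex_trace_misses:
  assumes i: "i \<in> {a..<b}"
    and P: "\<And>w. w \<in> {rec_start T vs a..<rec_start T vs b} \<Longrightarrow> \<not> P w"
  shows "length (filter P (vertex_trace T vs i)) \<le> length (filter (\<lambda>j. j \<notin> {a..<b}) (nbr_idx T vs i))"
proof -
  let ?s = "rec_start T vs i" and ?ns = "nbr_idx T vs i"
  have hi: "?s + 1 + 2 * length ?ns \<le> rec_start T vs b"
    using rec_start_mono[of "Suc i" b T vs] i by (simp add: rec_start_Suc rec_size_def)
  have lo: "rec_start T vs a \<le> ?s" using i by (intro rec_start_mono) auto
  have own: "\<not> P (?s + w)" if "w < 1 + 2 * length ?ns" for w
    using that hi lo by (intro P) auto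
  have other: "\<not> P (rec_start T vs j)" if "j \<in> {a..<b}" for j
    using that by (intro P) (auto intro: rec_start_mono rec_start_less)
  have s: "\<not> P ?s" using own[of 0] by simp
  have "length (filter P (vertex_trace T vs i))
      = (\<Sum>k\<leftarrow>[0..<length ?ns]. length (filter P [?s + 1 + 2 * k, ?s + 2 + 2 * k, rec_start T vs (?ns ! k)]))"
    using s by (simp only: vertex_trace_def Let_def filter_append length_append
      length_filter_concat_map) simp
  also have "\<dots> \<le> (\<Sum>k\<leftarrow>[0..<length ?ns]. if ?ns ! k \<notin> {a..<b} then 1 else 0)"
  proof (rule sum_list_mono)
    fix k assume "k \<in> set [0..<length ?ns]"
    then have "1 + 2 * k < 1 + 2 * length ?ns" "2 + 2 * k < 1 + 2 * length ?ns" by auto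
    from own[OF this(1)] own[OF this(2)]
    have "\<not> P (?s + 1 + 2 * k)" "\<not> P (?s + 2 + 2 * k)" by (simp_all only: add.assoc not_False_eq_True)
    then show "length (filter P [?s + 1 + 2 * k, ?s + 2 + 2 * k, rec_start T vs (?ns ! k)])
        \<le> (if ?ns ! k \<notin> {a..<b} then 1 else 0)"
      using other[of "?ns ! k"] by (simp only: filter.simps) simp
  qed
  also have "\<dots> = (\<Sum>j\<leftarrow>map (\<lambda>k. ?ns ! k) [0..<length ?ns]. if j \<notin> {a..<b} then 1 else 0)"
    by (simp add: o_def)
  also have "\<dots> = length (filter (\<lambda>j. j \<notin> {a..<b}) ?ns)"
  proof -
    have "(\<Sum>j\<leftarrow>xs. if j \<notin> {a..<b} then 1 else 0) = length (filter (\<lambda>j. j \<notin> {a..<b}) xs)" for xs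
      by (induction xs) auto
    then show ?thesis by (simp only: map_nth)
  qed
  finally show ?thesis .
qed

text \<open>The range need not be aligned with block boundaries, which accounts for the two
  additional blocks.\<close>

lemma card_blocks_le:
  assumes "a \<le> b"
  shows "real (card ((\<lambda>w. w div B) ` {a..<b})) \<le> real (b - a) / real B + 2"
proof -
  have "(\<lambda>w. w div B) ` {a..<b} \<subseteq> {a div B..b div B}"
    by (auto intro!: div_le_mono)
  then have "card ((\<lambda>w. w div B) ` {a..<b}) \<le> Suc (b div B) - a div B"
    using card_mono[of "{a div B..b div B}"] by fastforce
  moreover have "b div B \<le> a div B + (b - a) div B + 1"
  proof (cases "B = 0")
    case False
    then have "a mod B + (b - a) mod B < 2 * B"
      using mod_less_divisor[of B a] mod_less_divisor[of B "b - a"] by linarith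
    then have "(a mod B + (b - a) mod B) div B < 2" by (rule less_mult_imp_div_less)
    then show ?thesis using div_add1_eq[of a "b - a" B] assms by simp
  qed simp
  ultimately have "card ((\<lambda>w. w div B) ` {a..<b}) \<le> (b - a) div B + 2" by linarith
  then show ?thesis using of_nat_div_le_of_nat[where 'a = real, of "b - a" B] by linarith
qed

lemma rec_size_le:
  fixes T :: "(real^'n) set set"
  assumes T: "well_shaped_mesh \<alpha> T" and \<alpha>: "0 < \<alpha>" and vs: "is_layout T vs"
  shows "rec_size T vs i \<le> 1 + 2 * degree_bound TYPE('n) \<alpha>"
proof -
  have "finite {q. mesh_adj T (vs ! i) q}"
    by (rule finite_subset[OF _ finite_mesh_vertices[OF T]]) (auto dest: mesh_adj_vertices)
  moreover have "(nth vs) ` set (nbr_idx T vs i) \<subseteq> {q. mesh_adj T (vs ! i) q}"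
    by (auto simp: nbr_idx_def)
  moreover have "inj_on (nth vs) (set (nbr_idx T vs i))"
    using vs by (auto simp: nbr_idx_def is_layout_def inj_on_def nth_eq_iff_index_eq)
  ultimately have "card (set (nbr_idx T vs i)) \<le> card {q. mesh_adj T (vs ! i) q}"
    by (metis card_inj_on_le)
  moreover have "card (set (nbr_idx T vs i)) = length (nbr_idx T vs i)"
    by (rule distinct_card) (simp add: nbr_idx_def)
  ultimately show ?thesis
    using mesh_degree_le[OF T \<alpha>, of "vs ! i"] by (simp add: rec_size_def)
qed

lemma rec_start_diff_le:
  fixes c :: real
  assumes "\<And>i. rec_size T vs i \<le> c" "a \<le> b"
  shows "real (rec_start T vs b - rec_start T vs a) \<le> c * (real b - real a)"
  using assms(2)
proof (induction b rule: dec_induct)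
  case base
  then show ?case by simp
next
  case (step b)
  then show ?case
    using assms(1)[of b] rec_start_mono[OF step.hyps(1), of T vs]
    by (simp add: rec_start_Suc of_nat_diff algebra_simps)
qed

section \<open>Segments as index intervals of the layout\<close>

definition offset :: "'a list list \<Rightarrow> nat \<Rightarrow> nat" where
  "offset ss j = length (concat (take j ss))"

lemma offset_0 [simp]: "offset ss 0 = 0"
  by (simp add: offset_def)

lemma offset_Suc: "j < length ss \<Longrightarrow> offset ss (Suc j) = offset ss j + length (ss ! j)"
  by (simp add: offset_def take_Suc_conv_app_nth)

lemma offset_length [simp]: "offset ss (length ss) = length (concat ss)"
  by (simp add: offset_def)

lemma offset_mono: "i \<le> j \<Longrightarrow> offset ss i \<le> offset ss j"
proof -
  assume "i \<le> j"
  then have "take j ss = take i ss @ take (j - i) (drop i ss)"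
    by (metis le_add_diff_inverse take_add)
  then show ?thesis by (simp add: offset_def)
qed

lemma set_segment:
  assumes "j < length ss"
  shows "set (ss ! j) = (nth (concat ss)) ` {offset ss j..<offset ss (Suc j)}"
proof -
  have "concat ss = concat (take j ss) @ ss ! j @ concat (drop (Suc j) ss)"
    by (metis assms concat.simps(2) concat_append id_take_nth_drop)
  then have "concat ss ! (offset ss j + i) = ss ! j ! i" if "i < length (ss ! j)" for i
    using that by (simp add: offset_def nth_append)
  moreover have "{offset ss j..<offset ss (Suc j)} = (\<lambda>i. offset ss j + i) ` {..<length (ss ! j)}"
    using assms by (auto simp: offset_Suc image_iff le_iff_add)
  ultimately show ?thesis by (auto simp: set_conv_nth image_image)
qed

lemma concat_map_segments:
  "concat (map (\<lambda>j. concat (map f [offset ss j..<offset ss (Suc j)])) [0..<m])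
     = concat (map f [0..<offset ss m])"
proof (induction m)
  case (Suc m)
  have "[0..<offset ss (Suc m)] = [0..<offset ss m] @ [offset ss m..<offset ss (Suc m)]"
    using offset_mono[of m "Suc m" ss]
      upt_add_eq_append[of 0 "offset ss m" "offset ss (Suc m) - offset ss m"] by simp
  then show ?case using Suc by simp
qed simp

text \<open>The pairs of a vertex index and an outside neighbour index are disjoint for different
  segments. As the layout is distinct, they map injectively to ordered crossing pairs.\<close>

lemma sum_outside_neighbours_le:
  assumes "distinct vs" and ss: "concat ss = vs"
  shows "(\<Sum>j<length ss. \<Sum>i\<in>{offset ss j..<offset ss (Suc j)}.
      length (filter (\<lambda>i'. i' \<notin> {offset ss j..<offset ss (Suc j)}) (nbr_idx T vs i)))
    \<le> card (crossing (mesh_adj T) ss)"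
proof -
  let ?I = "\<lambda>j. {offset ss j..<offset ss (Suc j)}"
  define N where "N = (\<lambda>j i. set (filter (\<lambda>i'. i' \<notin> ?I j) (nbr_idx T vs i)))"
  define Y where "Y = (\<lambda>j. SIGMA i:?I j. N j i)"
  have I_disj: "j = l" if "i \<in> ?I j" "i \<in> ?I l" for i j l
  proof (rule ccontr)
    assume "j \<noteq> l"
    then consider "Suc j \<le> l" | "Suc l \<le> j" by linarith
    then show False using that offset_mono[of "Suc j" l ss] offset_mono[of "Suc l" j ss] by cases auto
  qed
  have I_lt: "?I j \<subseteq> {..<length vs}" if "j < length ss" for j
    using offset_mono[of "Suc j" "length ss" ss] that ss by auto
  have inj: "inj_on (nth vs) {..<length vs}"
    using \<open>distinct vs\<close> by (simp add: inj_on_nth)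
  have Y_lt: "Y j \<subseteq> {..<length vs} \<times> {..<length vs}" if "j < length ss" for j
    using I_lt[OF that] by (auto simp: Y_def N_def nbr_idx_def)
  have finY: "finite (Y j)" for j by (auto simp: Y_def N_def)
  have "length (filter (\<lambda>i'. i' \<notin> ?I j) (nbr_idx T vs i)) = card (N j i)" for i j
    unfolding N_def by (rule distinct_card[symmetric]) (simp add: nbr_idx_def)
  then have "(\<Sum>j<length ss. \<Sum>i\<in>?I j. length (filter (\<lambda>i'. i' \<notin> ?I j) (nbr_idx T vs i)))
      = (\<Sum>j<length ss. card (Y j))"
    by (simp add: Y_def N_def)
  also have "\<dots> = card (\<Union>j<length ss. Y j)"
    by (rule card_UN_disjoint[symmetric]) (use finY I_disj in \<open>auto simp: Y_def\<close>)
  also have "\<dots> \<le> card (crossing (mesh_adj T) ss)"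
  proof (rule card_inj_on_le[where f = "map_prod (nth vs) (nth vs)"])
    show "inj_on (map_prod (nth vs) (nth vs)) (\<Union>j<length ss. Y j)"
      by (rule inj_on_subset[OF map_prod_inj_on[OF inj inj]]) (use Y_lt in blast)
    show "map_prod (nth vs) (nth vs) ` (\<Union>j<length ss. Y j) \<subseteq> crossing (mesh_adj T) ss"
    proof (rule image_subsetI)
      fix z assume "z \<in> (\<Union>j<length ss. Y j)"
      then obtain i i' j where j: "j < length ss" and Y: "(i, i') \<in> Y j" and z: "z = (i, i')"
        by (metis UN_E lessThan_iff surj_pair)
      then have lt: "i < length vs" "i' < length vs" using Y_lt[OF j] by auto
      have ij: "i \<in> ?I j" "i' \<notin> ?I j" and adj: "mesh_adj T (vs ! i) (vs ! i')"
        using Y by (auto simp: Y_def N_def nbr_idx_def)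
      \<comment> \<open>A segment containing both vertices would contain both indices in its
        interval; by disjointness this interval is \<open>?I j\<close>, which excludes
        \<open>i'\<close>.\<close>
      have "False" if s: "s \<in> set ss" "vs ! i \<in> set s" "vs ! i' \<in> set s" for s
      proof -
        obtain l where l: "l < length ss" "s = ss ! l" using s(1) by (metis in_set_conv_nth)
        have "x \<in> ?I l" if x: "x < length vs" "vs ! x \<in> set s" for x
        proof -
          obtain y where "y \<in> ?I l" "vs ! x = vs ! y"
            using x(2) l set_segment[OF l(1)] ss by auto
          then show ?thesis using inj x(1) I_lt[OF l(1)] by (metis inj_onD lessThan_iff subsetD)
        qed
        then have "i \<in> ?I l" "i' \<in> ?I l" using s lt by auto
        then show False using I_disj[of i j l] ij by auto
      qed
      then have "(vs ! i, vs ! i') \<in> crossing (mesh_adj T) ss"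
        using lt adj ss by (auto simp: crossing_def simp del: set_concat)
      then show "map_prod (nth vs) (nth vs) z \<in> crossing (mesh_adj T) ss" by (simp add: z)
    qed
  qed (rule finite_crossing)
  finally show ?thesis .
qed

text \<open>Each segment is one phase whose working set consists of the blocks meeting its records.
  These are at most \<open>c * k / B + 2\<close> blocks, and one more slot is kept for outside
  accesses, hence \<open>3 * B\<close> in the cache requirement.\<close>

lemma layout_transfers:
  fixes c :: real
  assumes vs: "is_layout T vs" and ss: "concat ss = vs" and c: "\<And>i. rec_size T vs i \<le> c" "0 \<le> c"
    and len: "\<And>s. s \<in> set ss \<Longrightarrow> length s \<le> k" and B: "1 \<le> B"
    and M: "c * k + 3 * B \<le> M"
  shows "\<exists>Cs. cache_run M B (mesh_update_trace T vs) Cs \<and>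
    real (transfers Cs) \<le> c * length vs / B + 2 * length ss + card (crossing (mesh_adj T) ss)"
proof -
  let ?st = "rec_start T vs" and ?m = "length ss"
  let ?a = "\<lambda>j. ?st (offset ss j)"
  define W where "W = (\<lambda>j. (\<lambda>w. w div B) ` {?a j..<?a (Suc j)})"
  define acc where "acc = (\<lambda>j. concat (map (vertex_trace T vs) [offset ss j..<offset ss (Suc j)]))"
  define phs where "phs = map (\<lambda>j. (W j, acc j)) [0..<?m]"
  have a_mono: "?a j \<le> ?a (Suc j)" for j by (intro rec_start_mono offset_mono) simp
  have W: "card (W j) \<le> (real (?a (Suc j)) - real (?a j)) / real B + 2" for j
    unfolding W_def using card_blocks_le[OF a_mono[of j], of B] a_mono[of j] by (simp add: of_nat_diff)
  have tr: "concat (map snd phs) = mesh_update_trace T vs"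
    using concat_map_segments[of "vertex_trace T vs" ss ?m]
    by (simp add: phs_def acc_def mesh_update_trace_def o_def ss)
  have fits: "finite (W j) \<and> card (W j) + 1 \<le> M div B" if "j < ?m" for j
  proof -
    have "real (?a (Suc j) - ?a j) \<le> c * (real (offset ss (Suc j)) - offset ss j)"
      by (rule rec_start_diff_le[OF c(1)]) (simp add: offset_mono)
    also have "\<dots> = c * length (ss ! j)" using that by (simp add: offset_Suc)
    also have "\<dots> \<le> c * k" using c(2) len[of "ss ! j"] that by (intro mult_left_mono) auto
    finally have "?a (Suc j) - real (?a j) \<le> c * k" using a_mono by (simp add: of_nat_diff)
    then have "(real (?a (Suc j)) - real (?a j)) / real B \<le> c * k / B" by (simp add: divide_right_mono)
    then have "real (card (W j) + 1) \<le> c * k / B + 3" using W[of j] by simp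
    then have "real (card (W j) + 1) * B \<le> (c * k / B + 3) * B" by (rule mult_right_mono) simp
    also have "\<dots> = c * k + 3 * B" using B by (simp add: distrib_right)
    also have "\<dots> \<le> M" using M by simp
    finally have "(card (W j) + 1) * B \<le> M" by (metis of_nat_le_iff of_nat_mult)
    then have "card (W j) + 1 \<le> M div B" using B by (simp add: less_eq_div_iff_mult_less_eq)
    then show ?thesis by (simp add: W_def)
  qed
  have miss: "length (filter (\<lambda>w. w div B \<notin> W j) (acc j)) \<le>
      (\<Sum>i\<in>{offset ss j..<offset ss (Suc j)}.
        length (filter (\<lambda>i'. i' \<notin> {offset ss j..<offset ss (Suc j)}) (nbr_idx T vs i)))" for j
    unfolding acc_def length_filter_concat_map sum_set_upt_conv_sum_list_nat[symmetric] set_upt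
    by (intro sum_mono vertex_trace_misses) (auto simp: W_def)
  have "(\<Sum>j<?m. length (filter (\<lambda>w. w div B \<notin> W j) (acc j)))
      \<le> (\<Sum>j<?m. \<Sum>i\<in>{offset ss j..<offset ss (Suc j)}.
            length (filter (\<lambda>i'. i' \<notin> {offset ss j..<offset ss (Suc j)}) (nbr_idx T vs i)))"
    by (rule sum_mono) (rule miss)
  also have "\<dots> \<le> card (crossing (mesh_adj T) ss)"
    using vs ss by (intro sum_outside_neighbours_le) (auto simp: is_layout_def)
  finally have misses: "(\<Sum>j<?m. length (filter (\<lambda>w. w div B \<notin> W j) (acc j)))
      \<le> card (crossing (mesh_adj T) ss)" .
  have "finite V \<and> card V + 1 \<le> M div B" if "(V, as) \<in> set phs" for V as
    using that fits by (auto simp: phs_def)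
  then obtain Cs
    where Cs: "cache_run M B (mesh_update_trace T vs) Cs"
    and "transfers Cs \<le> (\<Sum>(W, as)\<leftarrow>phs. card W + length (filter (\<lambda>a. a div B \<notin> W) as))"
    using phased_cache_run[of phs M B] unfolding tr by blast
  then have "transfers Cs \<le> (\<Sum>j<?m. card (W j) + length (filter (\<lambda>a. a div B \<notin> W j) (acc j)))"
    by (simp add: phs_def o_def interv_sum_list_conv_sum_set_nat atLeast0LessThan)
  also have "\<dots> \<le> (\<Sum>j<?m. card (W j)) + card (crossing (mesh_adj T) ss)"
    using misses by (simp add: sum.distrib)
  finally have "real (transfers Cs) \<le> (\<Sum>j<?m. real (card (W j))) + card (crossing (mesh_adj T) ss)"
    by (metis of_nat_add of_nat_le_iff of_nat_sum)
  also have "(\<Sum>j<?m. real (card (W j))) \<le> (\<Sum>j<?m. (real (?a (Suc j)) - real (?a j)) / real B + 2)"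
    by (rule sum_mono) (rule W)
  also have "\<dots> = (\<Sum>j<?m. real (?a (Suc j)) - real (?a j)) / B + 2 * ?m"
    by (simp add: sum.distrib sum_divide_distrib)
  \<comment> \<open>Consecutive segments are adjacent in memory, so their lengths telescope to the
    length of all records.\<close>
  also have "(\<Sum>j<?m. real (?a (Suc j)) - real (?a j)) = real (?st (length vs))"
    by (subst sum_lessThan_telescope) (simp add: ss rec_start_def)
  also have "\<dots> \<le> c * length vs"
    using rec_start_diff_le[OF c(1), of 0 "length vs"] by (simp add: rec_start_def)
  finally have "real (transfers Cs) \<le> c * length vs / B + 2 * ?m + card (crossing (mesh_adj T) ss)"
    using B by (simp add: divide_right_mono)
  then show ?thesis using Cs by blast
qed

section \<open>Constants and the cache-oblivious bound\<close>

theorem theorem5: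
  assumes "CARD('n::finite) > 1"
  shows "\<forall>\<alpha>::real. \<exists>c>0. \<exists>C>0. \<forall>T :: (real^'n) set set.
           well_shaped_mesh \<alpha> T \<longrightarrow>
           (\<exists>vs. is_layout T vs \<and>
              (\<forall>B M::nat. B \<ge> 1 \<and> real M \<ge> c * real B ^ CARD('n) \<longrightarrow>
                 (\<exists>Cs. cache_run M B (mesh_update_trace T vs) Cs \<and>
                       real (transfers Cs) \<le> C * (1 + real (mesh_size T) / real B))))"
proof
  fix \<alpha>0 :: real
  let ?d = "CARD('n)"
  \<comment> \<open>Raising the aspect-ratio bound keeps the mesh well-shaped and makes the bound
    positive.\<close>
  define \<alpha> where "\<alpha> = max \<alpha>0 1"
  have \<alpha>: "0 < \<alpha>" by (simp add: \<alpha>_def)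
  obtain N :: "(real^'n) set" where N: "finite N" "cball 0 2 \<subseteq> (\<Union>x\<in>N. ball x (1/2))"
  proof -
    have "compact (cball (0::real^'n) 2)" by simp
    then show ?thesis
      using that by (metis compact_eq_totally_bounded half_gt_zero zero_less_one)
  qed
  then have "N \<noteq> {}" by (metis UN_empty centre_in_cball empty_iff subset_iff zero_le_numeral)
  define \<delta> where "\<delta> = 1 / (2 * real (card N))"
  have \<delta>: "0 < \<delta>" using N(1) \<open>N \<noteq> {}\<close> by (simp add: \<delta>_def card_gt_0_iff)
  define \<Delta> where "\<Delta> = degree_bound TYPE('n) \<alpha>"
  have \<Delta>: "0 \<le> \<Delta>" using \<alpha> by (simp add: \<Delta>_def degree_bound_def)
  \<comment> \<open>The constant of \<open>separator_layout\<close> for cut constant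
    \<open>2 * \<Delta>\<close> and exponent \<open>\<beta> = 1 / d\<close>.\<close>
  define K where "K = 2 * (2 * \<Delta>) / (\<delta> * (2 powr (1 / ?d) - 1)) * \<delta> powr - (1 / ?d)"
  have K: "0 \<le> K" using \<Delta> \<delta> by (simp add: K_def ge_one_powr_ge_zero)
  \<comment> \<open>A record has at most \<open>1 + 2 * \<Delta>\<close> words; the remaining 3
    covers the \<open>3 * B\<close> words of extra room, since \<open>B \<le> B ^ d\<close>.\<close>
  define c where "c = 4 + 2 * \<Delta>"
  define C where "C = 3 + 2 * \<Delta> + 2 / \<delta> + K"
  have "\<exists>vs. is_layout T vs \<and>
      (\<forall>B M::nat. B \<ge> 1 \<and> real M \<ge> c * real B ^ ?d \<longrightarrow>
         (\<exists>Cs. cache_run M B (mesh_update_trace T vs) Cs \<and>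
               real (transfers Cs) \<le> C * (1 + real (mesh_size T) / real B)))"
    if T0: "well_shaped_mesh \<alpha>0 T" for T :: "(real^'n) set set"
  proof -
    have T: "well_shaped_mesh \<alpha> T"
      using T0 by (fastforce simp: well_shaped_mesh_def \<alpha>_def)
    have sep: "\<exists>A\<subseteq>W. \<delta> * card W \<le> card A \<and> \<delta> * card W \<le> card (W - A) \<and>
        card (cut (mesh_adj T) A (W - A)) \<le> 2 * \<Delta> * card W powr (1 - 1 / ?d)"
      if "W \<subseteq> mesh_vertices T" "2 \<le> card W" for W
      unfolding \<delta>_def \<Delta>_def using mesh_separator[OF T \<alpha> N(2,1) that] .
    have "\<exists>vs. distinct vs \<and> set vs = mesh_vertices T \<and> (\<forall>k::nat. k \<ge> 1 \<longrightarrow>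
        (\<exists>ss. concat ss = vs \<and> (\<forall>s\<in>set ss. length s \<le> k) \<and>
           length ss \<le> 1 + card (mesh_vertices T) / (\<delta> * k) \<and>
           card (crossing (mesh_adj T) ss) \<le> K * card (mesh_vertices T) / k powr (1 / ?d)))"
      unfolding K_def
      by (rule separator_layout[OF symp_mesh_adj finite_mesh_vertices[OF T] \<delta> _ _ sep])
         (use \<Delta> in auto)
    \<comment> \<open>The order is fixed before \<open>B\<close> and \<open>M\<close> appear; only
      the division into segments, with \<open>k = B ^ d\<close>, depends on
      \<open>B\<close>.\<close>
    then obtain vs where vs: "distinct vs" "set vs = mesh_vertices T" and
      seg: "\<And>k::nat. k \<ge> 1 \<Longrightarrow> \<exists>ss. concat ss = vs \<and> (\<forall>s\<in>set ss. length s \<le> k) \<and>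
           length ss \<le> 1 + card (mesh_vertices T) / (\<delta> * k) \<and>
           card (crossing (mesh_adj T) ss) \<le> K * card (mesh_vertices T) / k powr (1 / ?d)"
      by blast
    have lay: "is_layout T vs" using vs by (simp add: is_layout_def)
    define n where "n = card (mesh_vertices T)"
    have n: "length vs = n" using vs by (simp add: n_def distinct_card[symmetric])
    have "\<exists>Cs. cache_run M B (mesh_update_trace T vs) Cs \<and>
        real (transfers Cs) \<le> C * (1 + real (mesh_size T) / real B)"
      if B: "1 \<le> B" and M: "c * real B ^ ?d \<le> real M" for B M :: nat
    proof -
      have Bd: "real B \<le> real B ^ ?d" using B by (simp add: self_le_power)
      have "1 \<le> B ^ ?d" using B by simp
      then obtain ss where ss: "concat ss = vs" "\<forall>s\<in>set ss. length s \<le> B ^ ?d"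
        and len: "length ss \<le> 1 + n / (\<delta> * real B ^ ?d)"
        and cross: "card (crossing (mesh_adj T) ss) \<le> K * n / real (B ^ ?d) powr (1 / ?d)"
        using seg[of "B ^ ?d"] by (auto simp: n_def)
      have "real (B ^ ?d) powr (1 / ?d) = B"
        using B by (simp add: powr_realpow[symmetric] powr_powr)
      then have cross': "card (crossing (mesh_adj T) ss) \<le> K * n / B" using cross by simp
      have "n / (\<delta> * real B ^ ?d) \<le> n / (\<delta> * B)"
        using Bd B \<delta> by (intro divide_left_mono mult_left_mono mult_pos_pos) auto
      then have len': "length ss \<le> 1 + n / (\<delta> * B)" using len by linarith
      have "(1 + 2 * \<Delta>) * (B ^ ?d) + 3 * B \<le> M"
      proof -
        have "c * real B ^ ?d = (1 + 2 * \<Delta>) * real B ^ ?d + 3 * real B ^ ?d"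
          by (simp add: c_def algebra_simps)
        then show ?thesis using M Bd unfolding of_nat_power by linarith
      qed
      then obtain Cs where Cs: "cache_run M B (mesh_update_trace T vs) Cs"
        and tr: "real (transfers Cs) \<le> (1 + 2 * \<Delta>) * length vs / B + 2 * length ss
                    + card (crossing (mesh_adj T) ss)"
        using layout_transfers[OF lay ss(1), of "1 + 2 * \<Delta>" "B ^ ?d" B M]
          rec_size_le[OF T \<alpha> lay] ss(2) B \<Delta> by (auto simp: \<Delta>_def)
      have "real (transfers Cs) \<le> (1 + 2 * \<Delta>) * n / B + 2 * (1 + n / (\<delta> * B)) + K * n / B"
        using tr len' cross' n by simp
      also have "\<dots> = 2 + (1 + 2 * \<Delta> + 2 / \<delta> + K) * (n / B)"
        using B \<delta> by (simp add: field_simps)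
      also have "\<dots> \<le> C * 1 + C * (n / B)"
        using \<Delta> \<delta> K by (intro add_mono mult_right_mono) (auto simp: C_def)
      also have "\<dots> \<le> C * (1 + real (mesh_size T) / real B)"
      proof -
        have "real n / B \<le> real (mesh_size T) / B"
          by (simp add: mesh_size_def n_def divide_right_mono)
        moreover have "0 \<le> C" using \<Delta> \<delta> K by (simp add: C_def)
        ultimately show ?thesis unfolding distrib_left by (intro add_left_mono mult_left_mono)
      qed
      finally show ?thesis using Cs by blast
    qed
    then show ?thesis using lay by blast
  qed
  moreover have "0 < c" "0 < C" using \<Delta> \<delta> K by (auto simp: c_def C_def add_pos_nonneg)
  ultimately show "\<exists>c>0. \<exists>C>0. \<forall>T :: (real^'n) set set.
           well_shaped_mesh \<alpha>0 T \<longrightarrow>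
           (\<exists>vs. is_layout T vs \<and>
              (\<forall>B M::nat. B \<ge> 1 \<and> real M \<ge> c * real B ^ CARD('n) \<longrightarrow>
                 (\<exists>Cs. cache_run M B (mesh_update_trace T vs) Cs \<and>
                       real (transfers Cs) \<le> C * (1 + real (mesh_size T) / real B))))"
    by blast
qed

end
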